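(* Let $A\in\mathbb{R}^{n\times n}$, $B\in\mathbb{R}^{n\times m}$, let $Q\in\mathbb{R}^{n\times n}$ be (symmetric) nonnegative definite, let $T>0$ and $x_0,x_f\in\mathbb{R}^n$. Suppose that there is a control $u\in B_\infty$ such that the solution of $\dot x=Ax+Bu$, $x(0)=x_0$, satisfies $x(T)=x_f$. Then there exists an optimal control for the following problem: minimize $$J[u]=\int_0^T \left(x(t)^\top Q x(t)+|u(t)|\right)dt$$ over all controls $u\in L^1((0,T);\mathbb{R}^m)\cap B_\infty$ that take the initial state $x_0$ at $t=0$ to $x_f$ at $t=T$. That is, there exists $\bar u\in L^1((0,T);\mathbb{R}^m)\cap B_\infty$ taking $x_0$ to $x_f$ at $t=T$ such that $J[\bar u]\le J[u]$ for every $u\in L^1((0,T);\mathbb{R}^m)\cap B_\infty$ taking $x_0$ to $x_f$ at $t=T$.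
   Context: For a control $u=(u^1,\ldots,u^m)^\top$, $x(\cdot)$ in $J[u]$ denotes the corresponding (absolutely continuous) solution of $\dot x=Ax+Bu$, $x(0)=x_0$ on $[0,T]$; $u$ takes $x_0$ to $x_f$ at $t=T$ if $x(T)=x_f$. $L^1((0,T);\mathbb{R}^m)$ is the space of measurable $\mathbb{R}^m$-valued functions with $\int_0^T|u(t)|\,dt<\infty$, where $|\cdot|$ is a fixed norm on $\mathbb{R}^m$. $L^\infty((0,T);\mathbb{R}^m)$ carries the norm $\|u\|_{L^\infty}=\max_{1\le i\le m}\operatorname{ess\,sup}_{[0,T]}|u^i(t)|$, and $B_\infty$ is its closed unit ball, i.e. the measurable $u$ with $|u^i(t)|\le 1$ for almost every $t\in[0,T]$ and all $i$. *)

theory Defs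
  imports "HOL-Analysis.Analysis"
begin

definition is_norm :: "('a::real_vector \<Rightarrow> real) \<Rightarrow> bool" where
  "is_norm N \<longleftrightarrow>
     (\<forall>v. 0 \<le> N v) \<and>
     (\<forall>v. N v = 0 \<longleftrightarrow> v = 0) \<and>
     (\<forall>c v. N (c *\<^sub>R v) = \<bar>c\<bar> * N v) \<and>
     (\<forall>v w. N (v + w) \<le> N v + N w)"

definition nonneg_definite :: "real^'n^'n \<Rightarrow> bool" where
  "nonneg_definite Q \<longleftrightarrow> transpose Q = Q \<and> (\<forall>v. 0 \<le> v \<bullet> (Q *v v))"

(* The library constant absolutely_continuous is about measures; this is the
   epsilon-delta notion for functions on the interval {a..b}. *)
definition abs_cont_on :: "real \<Rightarrow> real \<Rightarrow> (real \<Rightarrow> 'a::real_normed_vector) \<Rightarrow> bool" where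
  "abs_cont_on a b f \<longleftrightarrow>
     (\<forall>\<epsilon>>0. \<exists>\<delta>>0. \<forall>(I::nat set) l r.
        finite I \<longrightarrow>
        (\<forall>i\<in>I. a \<le> l i \<and> l i \<le> r i \<and> r i \<le> b) \<longrightarrow>
        disjoint_family_on (\<lambda>i. {l i<..<r i}) I \<longrightarrow>
        (\<Sum>i\<in>I. r i - l i) < \<delta> \<longrightarrow>
        (\<Sum>i\<in>I. norm (f (r i) - f (l i))) < \<epsilon>)"

(* Controls are functions on the whole real line of which only the values on {0..T}
   matter. Since lebesgue is complete, {0..T} and {0<..<T} give the same spaces. *)
definition L1_controls :: "(real^'m \<Rightarrow> real) \<Rightarrow> real \<Rightarrow> (real \<Rightarrow> real^'m) set" where
  "L1_controls N T =
     {u. u \<in> borel_measurable (lebesgue_on {0..T}) \<and>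
         integrable (lebesgue_on {0..T}) (\<lambda>t. N (u t))}"

definition B_inf :: "real \<Rightarrow> (real \<Rightarrow> real^'m) set" where
  "B_inf T =
     {u. u \<in> borel_measurable (lebesgue_on {0..T}) \<and>
         (\<forall>i. AE t in lebesgue_on {0..T}. \<bar>u t $ i\<bar> \<le> 1)}"

definition is_solution ::
  "real^'n^'n \<Rightarrow> real^'m^'n \<Rightarrow> real \<Rightarrow> real^'n \<Rightarrow> (real \<Rightarrow> real^'m) \<Rightarrow> (real \<Rightarrow> real^'n) \<Rightarrow> bool" where
  "is_solution A B T x0 u x \<longleftrightarrow>
     abs_cont_on 0 T x \<and> x 0 = x0 \<and>
     (AE t in lebesgue_on {0..T}.
        (x has_vector_derivative (A *v x t + B *v u t)) (at t within {0..T}))"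

definition takes ::
  "real^'n^'n \<Rightarrow> real^'m^'n \<Rightarrow> real \<Rightarrow> real^'n \<Rightarrow> real^'n \<Rightarrow> (real \<Rightarrow> real^'m) \<Rightarrow> bool" where
  "takes A B T x0 xf u \<longleftrightarrow> (\<exists>x. is_solution A B T x0 u x \<and> x T = xf)"

(* For an integrable control the solution exists and is unique on {0..T}; the choice
   only affects values outside {0..T}. *)
definition state ::
  "real^'n^'n \<Rightarrow> real^'m^'n \<Rightarrow> real \<Rightarrow> real^'n \<Rightarrow> (real \<Rightarrow> real^'m) \<Rightarrow> real \<Rightarrow> real^'n" where
  "state A B T x0 u = (SOME x. is_solution A B T x0 u x)"

definition J ::
  "real^'n^'n \<Rightarrow> real^'m^'n \<Rightarrow> real^'n^'n \<Rightarrow> (real^'m \<Rightarrow> real) \<Rightarrow> real \<Rightarrow> real^'n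
     \<Rightarrow> (real \<Rightarrow> real^'m) \<Rightarrow> real" where
  "J A B Q N T x0 u =
     (let x = state A B T x0 u
      in \<integral>t. (x t \<bullet> (Q *v x t) + N (u t)) \<partial>lebesgue_on {0..T})"

end

theory Submission
  imports Defs
begin

text \<open>
The problem is convex: the admissible controls form a convex set, the trajectory depends affinely on
the control, and the integrand is convex because \<open>Q\<close> is nonnegative definite and
\<open>N\<close> is a norm. Weak compactness of the set of admissible controls in \<open>L\<^sup>2\<close> would
give a minimizer; the proof replaces it by an elementary argument that yields strong convergence.

Among the controls whose cost is within \<open>1/k\<close> of the infimum, take one whose
\<open>L\<^sup>2\<close> norm is almost minimal. By the parallelogram law these controls form a Cauchy
sequence in \<open>L\<^sup>2\<close>, since the midpoint of two of them is again nearly optimal and its norm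
cannot be much smaller than theirs (\<open>near_minimizers_fast_sequence\<close>). A subsequence converges
almost everywhere (\<open>AE_convergent_L2_fast\<close>). The controls are uniformly bounded, so dominated
convergence applies: the trajectories converge uniformly to a trajectory of the limit control
(\<open>solution_limit\<close>), the end point is preserved, and the costs converge to the cost of the
limit (\<open>J_limit\<close>), which is therefore optimal.

The solution concept, an absolutely continuous function satisfying the differential equation almost
everywhere, is equivalent to an integral equation. One direction is the fundamental theorem of
calculus for absolutely continuous functions (\<open>abs_cont_on_has_integral\<close>), the other is
Lebesgue's differentiation theorem (\<open>lebesgue_differentiation_interval\<close>). With the integral
equation, Gronwall's inequality gives uniqueness and stability of trajectories
(\<open>solution_stability\<close>), so no explicit solution formula is needed.
\<close>

section \<open>Absolutely continuous functions and the Lebesgue derivative\<close>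

lemma abs_cont_on_finite_family:
  fixes f :: "real \<Rightarrow> 'a::real_normed_vector"
  assumes "abs_cont_on a b f" "\<epsilon> > 0"
  obtains \<delta> where "\<delta> > 0"
    "\<And>(I::'i set) l r. \<lbrakk>finite I; \<And>i. i \<in> I \<Longrightarrow> a \<le> l i \<and> l i \<le> r i \<and> r i \<le> b;
        disjoint_family_on (\<lambda>i. {l i<..<r i}) I; (\<Sum>i\<in>I. r i - l i) < \<delta>\<rbrakk>
        \<Longrightarrow> (\<Sum>i\<in>I. norm (f (r i) - f (l i))) < \<epsilon>"
proof -
  obtain \<delta> where "\<delta> > 0" and \<delta>: "\<And>(I::nat set) l r. \<lbrakk>finite I; \<forall>i\<in>I. a \<le> l i \<and> l i \<le> r i \<and> r i \<le> b;
        disjoint_family_on (\<lambda>i. {l i<..<r i}) I; (\<Sum>i\<in>I. r i - l i) < \<delta>\<rbrakk>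
        \<Longrightarrow> (\<Sum>i\<in>I. norm (f (r i) - f (l i))) < \<epsilon>"
    using assms unfolding abs_cont_on_def by meson
  show thesis
  proof (rule that[OF \<open>\<delta> > 0\<close>])
    fix I :: "'i set" and l r
    assume I: "finite I" "\<And>i. i \<in> I \<Longrightarrow> a \<le> l i \<and> l i \<le> r i \<and> r i \<le> b"
      "disjoint_family_on (\<lambda>i. {l i<..<r i}) I" "(\<Sum>i\<in>I. r i - l i) < \<delta>"
    obtain h where h: "bij_betw h {0..<card I} I"
      using ex_bij_betw_nat_finite[OF I(1)] by blast
    have "(\<Sum>k\<in>{0..<card I}. norm (f ((r \<circ> h) k) - f ((l \<circ> h) k))) < \<epsilon>"
    proof (rule \<delta>)
      show "\<forall>k\<in>{0..<card I}. a \<le> (l \<circ> h) k \<and> (l \<circ> h) k \<le> (r \<circ> h) k \<and> (r \<circ> h) k \<le> b"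
        using I(2) bij_betwE[OF h] by auto
      show "disjoint_family_on (\<lambda>i. {(l \<circ> h) i<..<(r \<circ> h) i}) {0..<card I}"
        using I(3) bij_betwE[OF h] bij_betw_imp_inj_on[OF h]
        unfolding disjoint_family_on_def inj_on_def by (metis comp_apply)
      show "(\<Sum>i = 0..<card I. (r \<circ> h) i - (l \<circ> h) i) < \<delta>"
        using I(4) sum.reindex_bij_betw[OF h, of "\<lambda>i. r i - l i"] by simp
    qed simp
    then show "(\<Sum>i\<in>I. norm (f (r i) - f (l i))) < \<epsilon>"
      using sum.reindex_bij_betw[OF h, of "\<lambda>i. norm (f (r i) - f (l i))"] by simp
  qed
qed

text \<open>The Henstock--Kurzweil gauge handles the exceptional null set directly. At points of
differentiability the gauge is the usual one, so that the increment over a tagged interval is close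
to the derivative at the tag times the length. Around points of the null set \<open>N\<close> the gauge
stays inside an open set \<open>U\<close> of measure below the \<open>\<delta>\<close> of absolute
continuity; the intervals tagged there are non-overlapping with total length below
\<open>\<delta>\<close>, so their increments are negligible.\<close>
theorem abs_cont_on_has_integral:
  fixes f :: "real \<Rightarrow> 'a::banach"
  assumes "a \<le> b" and ac: "abs_cont_on a b f" and N: "negligible N"
    and der: "\<And>x. x \<in> {a..b} - N \<Longrightarrow> (f has_vector_derivative f' x) (at x within {a..b})"
  shows "(f' has_integral (f b - f a)) {a..b}"
proof -
  define g where "g x = (if x \<in> N then 0 else f' x)" for x
  have "(g has_integral (f b - f a)) (cbox a b)"
    unfolding has_integral
  proof (intro allI impI)
    fix e :: real assume "e > 0"
    \<comment> \<open>the summand 1 keeps the denominator positive when the interval is degenerate\<close>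
    define \<eta> where "\<eta> = e / (2 * (b - a + 1))"
    have "\<eta> > 0" using \<open>e > 0\<close> \<open>a \<le> b\<close> by (simp add: \<eta>_def)
    obtain \<delta> where "\<delta> > 0" and \<delta>: 
      "\<And>(I::(real \<times> real set) set) l r. \<lbrakk>finite I; \<And>i. i \<in> I \<Longrightarrow> a \<le> l i \<and> l i \<le> r i \<and> r i \<le> b;
        disjoint_family_on (\<lambda>i. {l i<..<r i}) I; (\<Sum>i\<in>I. r i - l i) < \<delta>\<rbrakk>
        \<Longrightarrow> (\<Sum>i\<in>I. norm (f (r i) - f (l i))) < e / 2"
      using abs_cont_on_finite_family[OF ac, of "e / 2"] \<open>e > 0\<close> half_gt_zero by blast
    obtain U where U: "open U" "N \<subseteq> U" "U \<in> lmeasurable" "measure lebesgue U < \<delta>"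
    proof -
      obtain U where "open U" "N \<subseteq> U" "U - N \<in> lmeasurable" "emeasure lebesgue (U - N) < ennreal \<delta>"
        using sets_lebesgue_outer_open[OF negligible_imp_sets[OF N] \<open>\<delta> > 0\<close>] .
      moreover have "U = (U - N) \<union> N" using \<open>N \<subseteq> U\<close> by blast
      moreover have "measure lebesgue (U - N) = measure lebesgue U"
        using N \<open>open U\<close> by (simp add: measure_Diff_null_set negligible_iff_null_sets)
      moreover have "measure lebesgue (U - N) < \<delta>"
        using calculation by (simp add: emeasure_eq_measure2 ennreal_less_iff)
      ultimately show ?thesis using that N
        by (metis fmeasurable.Un negligible_imp_measurable)
    qed
    have "\<forall>x. \<exists>d>0. (x \<in> {a..b} - N \<longrightarrow>
         (\<forall>y\<in>{a..b}. norm (y-x) < d \<longrightarrow> norm (f y - f x - (y-x) *\<^sub>R f' x) \<le> \<eta> * norm (y-x)))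
         \<and> (x \<in> N \<longrightarrow> ball x d \<subseteq> U)"
    proof
      fix x
      consider "x \<in> N" | "x \<in> {a..b} - N" | "x \<notin> {a..b} \<union> N" by blast
      then show "\<exists>d>0. (x \<in> {a..b} - N \<longrightarrow>
         (\<forall>y\<in>{a..b}. norm (y-x) < d \<longrightarrow> norm (f y - f x - (y-x) *\<^sub>R f' x) \<le> \<eta> * norm (y-x)))
         \<and> (x \<in> N \<longrightarrow> ball x d \<subseteq> U)"
      proof cases
        case 1
        then show ?thesis using U by (meson DiffD2 open_contains_ball_eq subsetD)
      next
        case 2
        then show ?thesis using der[OF 2] \<open>\<eta> > 0\<close>
          unfolding has_vector_derivative_def has_derivative_within_alt by blast
      qed (auto intro: zero_less_one)
    qed
    then obtain d where d: "\<And>x. 0 < d x"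
        "\<And>x y. \<lbrakk>x \<in> {a..b} - N; y \<in> {a..b}; norm (y-x) < d x\<rbrakk>
                        \<Longrightarrow> norm (f y - f x - (y-x) *\<^sub>R f' x) \<le> \<eta> * norm (y-x)"
        "\<And>x. x \<in> N \<Longrightarrow> ball x (d x) \<subseteq> U"
      by metis
    show "\<exists>\<gamma>. gauge \<gamma> \<and> (\<forall>p. p tagged_division_of cbox a b \<and> \<gamma> fine p \<longrightarrow>
       norm ((\<Sum>(x, k)\<in>p. measure lborel k *\<^sub>R g x) - (f b - f a)) < e)"
    proof (rule exI, safe)
      show "gauge (\<lambda>x. ball x (d x))"
        using d(1) gauge_ball_dependent by blast
    next
      fix p
      assume ptag: "p tagged_division_of cbox a b" and finep: "(\<lambda>x. ball x (d x)) fine p"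
      note p = tagged_division_ofD[OF ptag]
      define q where "q = {z \<in> p. fst z \<in> N}"
      have q: "q \<subseteq> p" "finite q" using p(1) by (auto simp: q_def)
      have tag: "Inf K \<le> x" "x \<le> Sup K" "a \<le> Inf K" "Sup K \<le> b" "K = {Inf K..Sup K}"
         "measure lborel K = Sup K - Inf K" "Inf K \<in> ball x (d x)" "Sup K \<in> ball x (d x)" "x \<in> {a..b}"
        if xK: "(x, K) \<in> p" for x K
      proof -
        obtain u v where k: "K = cbox u v" using p(4)[OF xK] by auto
        then have "u \<le> v" using p(2)[OF xK] by auto
        moreover have "K \<subseteq> ball x (d x)" using finep xK by (auto simp: fine_def)
        ultimately show "Inf K \<le> x" "x \<le> Sup K" "a \<le> Inf K" "Sup K \<le> b" "K = {Inf K..Sup K}"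
         "measure lborel K = Sup K - Inf K" "Inf K \<in> ball x (d x)" "Sup K \<in> ball x (d x)" "x \<in> {a..b}"
          using k p(2,3)[OF xK] by (auto simp: subset_iff)
      qed
      have le_z: "Inf (snd z) \<le> Sup (snd z)" if "z \<in> p" for z
        by (rule order_trans[OF tag(1,2)[of "fst z" "snd z"]]) (use that in auto)
      have ba: "b - a = (\<Sum>(x,K)\<in>p. Sup K - Inf K)" "f b - f a = (\<Sum>(x,K)\<in>p. f(Sup K) - f(Inf K))"
        using additive_tagged_division_1[where f= "\<lambda>x. x"] additive_tagged_division_1[where f= f]
            \<open>a \<le> b\<close> ptag by auto
      have disj: "disjoint_family_on (\<lambda>z. {Inf (snd z)<..<Sup (snd z)}) q"
        unfolding disjoint_family_on_def
      proof (intro ballI impI)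
        fix z w assume zw: "z \<in> q" "w \<in> q" "z \<noteq> w"
        have "interior (snd z) \<inter> interior (snd w) = {}"
          by (rule p(5)[of "fst z" "snd z" "fst w" "snd w"]) (use zw q(1) in \<open>auto simp: prod_eq_iff\<close>)
        moreover have "interior (snd z) = {Inf (snd z)<..<Sup (snd z)}" if "z \<in> q" for z
        proof -
          have "snd z = {Inf (snd z)..Sup (snd z)}" by (rule tag(5)[of "fst z"]) (use that q(1) in auto)
          then have "interior (snd z) = interior {Inf (snd z)..Sup (snd z)}" by (rule arg_cong)
          then show ?thesis by (simp only: interior_atLeastAtMost_real)
        qed
        ultimately show "{Inf (snd z)<..<Sup (snd z)} \<inter> {Inf (snd w)<..<Sup (snd w)} = {}"
          using zw by metis
      qed
      have len: "(\<Sum>z\<in>q. Sup (snd z) - Inf (snd z)) < \<delta>"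
      proof -
        have "(\<Sum>z\<in>q. Sup (snd z) - Inf (snd z)) = (\<Sum>z\<in>q. measure lebesgue {Inf (snd z)<..<Sup (snd z)})"
        proof (rule sum.cong[OF refl])
          fix z assume "z \<in> q"
          then have "Inf (snd z) \<le> Sup (snd z)" using q(1) by (intro le_z) auto
          then show "Sup (snd z) - Inf (snd z) = measure lebesgue {Inf (snd z)<..<Sup (snd z)}" by simp
        qed
        also have "\<dots> = measure lebesgue (\<Union>z\<in>q. {Inf (snd z)<..<Sup (snd z)})"
        proof (rule measure_finite_Union[symmetric, OF q(2) _ disj])
          show "emeasure lebesgue {Inf (snd z)<..<Sup (snd z)} \<noteq> \<infinity>" if "z \<in> q" for z
            using fmeasurableD2[of "{Inf (snd z)<..<Sup (snd z)}" lebesgue] by auto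
        qed auto
        also have "\<dots> \<le> measure lebesgue U"
        proof (rule measure_mono_fmeasurable[OF _ _ U(3)])
          show "(\<Union>z\<in>q. {Inf (snd z)<..<Sup (snd z)}) \<subseteq> U"
          proof safe
            fix t x K assume xK: "(x, K) \<in> q" and t: "t \<in> {Inf (snd (x,K))<..<Sup (snd (x,K))}"
            then have "t \<in> ball x (d x)" using tag(7,8)[of x K] q(1)
              by (auto simp: dist_real_def)
            then show "t \<in> U" using d(3)[of x] xK by (auto simp: q_def)
          qed
        qed (use q in auto)
        finally show ?thesis using U by simp
      qed
      have small: "(\<Sum>z\<in>q. norm (f (Sup (snd z)) - f (Inf (snd z)))) < e / 2"
      proof (rule \<delta>[OF q(2) _ disj len])
        fix i assume "i \<in> q"
        then show "a \<le> Inf (snd i) \<and> Inf (snd i) \<le> Sup (snd i) \<and> Sup (snd i) \<le> b"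
          using subsetD[OF q(1) \<open>i \<in> q\<close>] tag(3,4)[of "fst i" "snd i"] le_z[of i] by simp
      qed
      have straddle: "norm (measure lborel K *\<^sub>R f' x - (f (Sup K) - f (Inf K))) \<le> \<eta> * (Sup K - Inf K)"
        if "(x, K) \<in> p - q" for x K
      proof -
        have xK: "(x, K) \<in> p" and x: "x \<in> {a..b} - N" using that tag(9) by (auto simp: q_def)
        note t = tag[OF xK]
        let ?u = "Inf K" and ?v = "Sup K"
        have "norm ((?v - ?u) *\<^sub>R f' x - (f ?v - f ?u)) = norm (f ?u - f x - (?u - x) *\<^sub>R f' x - (f ?v - f x - (?v - x) *\<^sub>R f' x))"
          by (auto simp: algebra_simps)
        also have "\<dots> \<le> norm (f ?u - f x - (?u - x) *\<^sub>R f' x) + norm (f ?v - f x - (?v - x) *\<^sub>R f' x)"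
          by (rule norm_triangle_ineq4)
        also have "\<dots> \<le> \<eta> * norm (?u - x) + \<eta> * norm (?v - x)"
          by (intro add_mono d(2) x) (use t in \<open>auto simp: dist_real_def\<close>)
        also have "\<dots> = \<eta> * (?v - ?u)"
          using t(1,2) by (simp add: algebra_simps)
        finally show ?thesis using t(6) by simp
      qed
      have "(\<Sum>(x, k)\<in>p. measure lborel k *\<^sub>R g x) - (f b - f a)
           = (\<Sum>(x, K)\<in>p. measure lborel K *\<^sub>R g x - (f (Sup K) - f (Inf K)))"
        by (simp add: ba split_def sum_subtractf)
      also have "norm \<dots> \<le> (\<Sum>(x, K)\<in>p. norm (measure lborel K *\<^sub>R g x - (f (Sup K) - f (Inf K))))"
        by (rule sum_norm_le) auto
      also have "\<dots> = (\<Sum>(x, K)\<in>q. norm (measure lborel K *\<^sub>R g x - (f (Sup K) - f (Inf K))))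
           + (\<Sum>(x, K)\<in>p-q. norm (measure lborel K *\<^sub>R g x - (f (Sup K) - f (Inf K))))"
        by (subst add.commute) (rule sum.subset_diff[OF q(1) p(1)])
      also have "(\<Sum>(x, K)\<in>q. norm (measure lborel K *\<^sub>R g x - (f (Sup K) - f (Inf K))))
           = (\<Sum>z\<in>q. norm (f (Sup (snd z)) - f (Inf (snd z))))"
        by (rule sum.cong) (auto simp: q_def g_def norm_minus_commute)
      also have "(\<Sum>(x, K)\<in>p-q. norm (measure lborel K *\<^sub>R g x - (f (Sup K) - f (Inf K))))
          \<le> (\<Sum>(x, K)\<in>p-q. \<eta> * (Sup K - Inf K))"
        by (rule sum_mono) (use straddle in \<open>auto simp: g_def q_def\<close>)
      also have "\<dots> \<le> (\<Sum>(x, K)\<in>p. \<eta> * (Sup K - Inf K))"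
        proof (rule sum_mono2[OF p(1)])
        fix z assume "z \<in> p - (p - q)"
        then have "Inf (snd z) \<le> Sup (snd z)" by (intro le_z) auto
        then show "0 \<le> (case z of (x, K) \<Rightarrow> \<eta> * (Sup K - Inf K))"
          using \<open>\<eta> > 0\<close> by (simp add: split_def)
      qed auto
      also have "\<dots> = \<eta> * (b - a)"
        by (simp add: ba split_def sum_distrib_left)
      also have "\<eta> * (b - a) \<le> e / 2"
        using \<open>e > 0\<close> \<open>a \<le> b\<close> by (simp add: \<eta>_def field_simps)
      finally show "norm ((\<Sum>(x, k)\<in>p. measure lborel k *\<^sub>R g x) - (f b - f a)) < e"
        using small by simp
    qed
  qed
  then have "(g has_integral (f b - f a)) {a..b}" by simp
  then show ?thesis
    by (rule has_integral_spike[OF N, rotated]) (simp add: g_def)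
qed

text \<open>Lebesgue's differentiation theorem on an interval, from Henstock's lemma and Vitali's covering
theorem. If the primitive \<open>F\<close> has a difference quotient at \<open>x\<close> that stays
\<open>\<eta>\<close> away from \<open>f x\<close> at arbitrarily small scales, then the
corresponding intervals with end point \<open>x\<close> form a Vitali cover of the set
\<open>E \<eta>\<close> of such points. Disjoint members of the cover that are fine for the gauge
of Henstock's lemma have a total error below \<open>\<eta> * e\<close>, while each of them
contributes at least \<open>\<eta>\<close> times its length; so the total length is at most
\<open>e\<close>, and \<open>E \<eta>\<close> is a null set.\<close>
theorem lebesgue_differentiation_interval:
  fixes f :: "real \<Rightarrow> 'a::euclidean_space"
  assumes f: "f integrable_on {a..b}"
  obtains N where "negligible N"
    "\<And>x. x \<in> {a..b} - N \<Longrightarrow> ((\<lambda>t. integral {a..t} f) has_vector_derivative f x) (at x within {a..b})"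
proof -
  define F where "F t = integral {a..t} f" for t
  define bad where "bad \<eta> x y \<longleftrightarrow> norm (F y - F x - (y - x) *\<^sub>R f x) > \<eta> * \<bar>y - x\<bar>" for \<eta> x y
  define E where "E \<eta> = {x \<in> {a..b}. \<forall>d>0. \<exists>y\<in>{a..b}. \<bar>y - x\<bar> < d \<and> bad \<eta> x y}" for \<eta>
  have incr: "norm (measure lborel {min x y..max x y} *\<^sub>R f x - integral {min x y..max x y} f)
       = norm (F y - F x - (y - x) *\<^sub>R f x)" if "x \<in> {a..b}" "y \<in> {a..b}" for x y
  proof -
    have *: "F v - F u = integral {u..v} f" if "a \<le> u" "u \<le> v" "v \<le> b" for u v
    proof -
      have "f integrable_on {a..v}" using f that by (meson atLeastatMost_subset_iff integrable_on_subinterval order_refl)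
      then show ?thesis
        using Henstock_Kurzweil_Integration.integral_combine[of a u v f] that
        by (metis F_def add_diff_cancel_left')
    qed
    show ?thesis
    proof (cases "x \<le> y")
      case True
      then show ?thesis using *[of x y] that by (simp add: min_def max_def norm_minus_commute)
    next
      case False
      then have "norm ((x - y) *\<^sub>R f x - (F x - F y)) = norm (F y - F x - (y - x) *\<^sub>R f x)"
        by (simp add: algebra_simps)
      then show ?thesis using False *[of y x] that by (simp add: min_def max_def)
    qed
  qed
  have negE: "negligible (E \<eta>)" if "\<eta> > 0" for \<eta>
    unfolding negligible_outer_le
  proof (intro allI impI)
    fix e :: real assume "e > 0"
    obtain \<gamma> where \<gamma>: "gauge \<gamma>" and hen: "\<And>p. \<lbrakk>p tagged_partial_division_of (cbox a b); \<gamma> fine p\<rbrakk> \<Longrightarrow>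
             sum (\<lambda>(x,k). norm(measure lborel k *\<^sub>R f x - integral k f)) p < \<eta> * e"
      using Henstock_lemma[of f a b "\<eta> * e"] f \<open>\<eta> > 0\<close> \<open>e > 0\<close> by auto
    define iv where "iv z = {min (fst z) (snd z)..max (fst z) (snd z)}" for z :: "real \<times> real"
    \<comment> \<open>the Vitali cover, indexed by pairs of tag and other end point; the balls of the covering theorem are the intervals between the two\<close>
    define V where "V = {(x, y). x \<in> E \<eta> \<and> y \<in> {a..b} \<and> bad \<eta> x y \<and> iv (x, y) \<subseteq> \<gamma> x}"
    define c where "c z = (fst z + snd z) / 2" for z :: "real \<times> real"
    define r where "r z = \<bar>fst z - snd z\<bar> / 2" for z :: "real \<times> real"
    have iv: "cball (c z) (r z) = iv z" for z
    proof -
      have "c z - r z = min (fst z) (snd z)" "c z + r z = max (fst z) (snd z)"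
        unfolding c_def r_def min_def max_def by (auto simp: field_simps)
      then show ?thesis by (simp add: cball_eq_atLeastAtMost iv_def)
    qed
    have fin: "measure lebesgue (\<Union>z\<in>C. iv z) \<le> e"
      if C: "C \<subseteq> V" "finite C" "pairwise (\<lambda>i j. disjnt (iv i) (iv j)) C" for C
    proof -
      let ?t = "\<lambda>z. (fst z, iv z)"
      have inj: "inj_on ?t C"
      proof (rule inj_onI)
        fix z w assume "z \<in> C" "w \<in> C" "?t z = ?t w"
        moreover have "fst z \<in> iv z" by (simp add: iv_def)
        ultimately show "z = w" using C(3) by (metis disjnt_iff pairwiseD prod.inject)
      qed
      have part: "?t ` C tagged_partial_division_of cbox a b"
        unfolding tagged_partial_division_of_def
      proof (intro conjI allI impI)
        show "finite (?t ` C)" using C by simp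
      next
        fix x K assume "(x, K) \<in> ?t ` C"
        then obtain z where "z \<in> C" "x = fst z" "K = iv z" by blast
        moreover have "fst z \<in> {a..b}" "snd z \<in> {a..b}"
          using \<open>z \<in> C\<close> C(1) by (auto simp: V_def E_def)
        ultimately show "x \<in> K" "K \<subseteq> cbox a b" "\<exists>a b. K = cbox a b"
          by (auto simp: iv_def simp del: box_real simp flip: cbox_interval)
      next
        fix x1 K1 x2 K2
        assume A: "(x1, K1) \<in> ?t ` C \<and> (x2, K2) \<in> ?t ` C \<and> (x1, K1) \<noteq> (x2, K2)"
        then have "disjnt K1 K2" using C(3) by (auto simp: pairwise_def)
        then show "interior K1 \<inter> interior K2 = {}"
          using interior_subset[of K1] interior_subset[of K2] unfolding disjnt_def by blast
      qed
      have "iv z \<subseteq> \<gamma> (fst z)" if "z \<in> C" for z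
        using subsetD[OF C(1) that] by (cases z) (simp add: V_def)
      then have fine: "\<gamma> fine ?t ` C"
        unfolding fine_def by blast
      have "measure lebesgue (\<Union>z\<in>C. iv z) \<le> (\<Sum>z\<in>C. measure lebesgue (iv z))"
        by (rule measure_UNION_le) (auto simp: C iv_def)
      also have "\<dots> = (\<Sum>z\<in>C. \<bar>snd z - fst z\<bar>)"
        by (rule sum.cong) (auto simp: iv_def)
      finally have "\<eta> * measure lebesgue (\<Union>z\<in>C. iv z) \<le> (\<Sum>z\<in>C. \<eta> * \<bar>snd z - fst z\<bar>)"
        using \<open>\<eta> > 0\<close> by (simp add: sum_distrib_left[symmetric])
      also have "\<dots> \<le> (\<Sum>z\<in>C. norm (measure lborel (iv z) *\<^sub>R f (fst z) - integral (iv z) f))"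
      proof (rule sum_mono)
        fix z assume "z \<in> C"
        then obtain x y where z: "z = (x, y)" "x \<in> {a..b}" "y \<in> {a..b}" "bad \<eta> x y"
          using C(1) by (auto simp: V_def E_def)
        show "\<eta> * \<bar>snd z - fst z\<bar> \<le> norm (measure lborel (iv z) *\<^sub>R f (fst z) - integral (iv z) f)"
          using z(4) incr[OF z(2,3)] by (simp add: z(1) iv_def bad_def)
      qed
      also have "\<dots> = (\<Sum>(x,k)\<in>?t ` C. norm (measure lborel k *\<^sub>R f x - integral k f))"
        by (simp add: sum.reindex[OF inj])
      also have "\<dots> < \<eta> * e" by (rule hen[OF part fine])
      finally show ?thesis using \<open>\<eta> > 0\<close> by simp
    qed
    obtain C where C: "countable C" "C \<subseteq> V" "pairwise (\<lambda>i j. disjnt (iv i) (iv j)) C"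
      and neg: "negligible (E \<eta> - (\<Union>z\<in>C. iv z))"
    proof (rule Vitali_covering_theorem_cballs[of V r "E \<eta>" c, unfolded iv])
      fix z assume "z \<in> V"
      then show "0 < r z" by (auto simp: r_def V_def bad_def)
    next
      fix x d :: real assume x: "x \<in> E \<eta>" "0 < d"
      obtain k where k: "k > 0" "ball x k \<subseteq> \<gamma> x"
        using \<gamma> by (meson gauge_def open_contains_ball_eq)
      have "0 < min d k" using x(2) k(1) by simp
      then obtain y where y: "y \<in> {a..b}" "\<bar>y - x\<bar> < min d k" "bad \<eta> x y"
        using x(1) unfolding E_def by blast
      have "iv (x, y) \<subseteq> ball x k"
        using y(2) by (auto simp: iv_def dist_real_def)
      then have "iv (x, y) \<subseteq> \<gamma> x" using k(2) by blast
      then have "(x, y) \<in> V" using x(1) y(1,3) by (simp add: V_def)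
      moreover have "x \<in> iv (x, y)" by (simp add: iv_def)
      moreover have "r (x, y) < d" using y(2) x(2) unfolding r_def by (simp add: abs_minus_commute)
      ultimately show "\<exists>i. i \<in> V \<and> x \<in> iv i \<and> r i < d" by blast
    qed
    have bd: "measure lebesgue (\<Union>z\<in>I. iv z) \<le> e" if "I \<subseteq> C" "finite I" for I
      using that C by (intro fin) (auto intro: pairwise_subset)
    have meas: "iv z \<in> lmeasurable" for z by (simp add: iv_def)
    have L: "(\<Union>z\<in>C. iv z) \<in> lmeasurable" "measure lebesgue (\<Union>z\<in>C. iv z) \<le> e"
      using fmeasurable_UN_bound[OF C(1) meas bd] measure_UN_bound[OF C(1) meas bd] by auto
    let ?W = "(\<Union>z\<in>C. iv z) \<union> (E \<eta> - (\<Union>z\<in>C. iv z))"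
    have "?W \<in> lmeasurable" by (rule fmeasurable.Un[OF L(1) negligible_imp_measurable[OF neg]])
    moreover have "measure lebesgue ?W \<le> e"
      using L(2) measure_Un_null_set[OF fmeasurableD[OF L(1)] neg[unfolded negligible_iff_null_sets]]
      by (simp only:)
    ultimately show "\<exists>T. E \<eta> \<subseteq> T \<and> T \<in> lmeasurable \<and> measure lebesgue T \<le> e"
      by (intro exI[of _ ?W]) auto
  qed
  show thesis
  proof
    show "negligible (\<Union>n::nat. E (inverse (real (Suc n))))"
      by (rule negligible_countable_Union) (use negE in auto)
  next
    fix x assume x: "x \<in> {a..b} - (\<Union>n::nat. E (inverse (real (Suc n))))"
    have "(F has_vector_derivative f x) (at x within {a..b})"
      unfolding has_vector_derivative_def has_derivative_within_alt
    proof (intro conjI allI impI bounded_linear_scaleR_left)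
      fix e :: real assume "e > 0"
      then obtain n where n: "inverse (real (Suc n)) < e" using reals_Archimedean by blast
      have xn: "x \<in> {a..b}" "x \<notin> E (inverse (real (Suc n)))"
        using x by (metis Diff_iff UN_I UNIV_I)+
      then obtain d where "d > 0" and d: "\<And>y. \<lbrakk>y \<in> {a..b}; \<bar>y - x\<bar> < d\<rbrakk> \<Longrightarrow> \<not> bad (inverse (real (Suc n))) x y"
        using xn unfolding E_def mem_Collect_eq by meson
      show "\<exists>d>0. \<forall>y\<in>{a..b}. norm (y - x) < d \<longrightarrow> norm (F y - F x - (y - x) *\<^sub>R f x) \<le> e * norm (y - x)"
      proof (intro exI[of _ d] conjI ballI impI \<open>d > 0\<close>)
        fix y assume "y \<in> {a..b}" "norm (y - x) < d"
        then have "norm (F y - F x - (y - x) *\<^sub>R f x) \<le> inverse (real (Suc n)) * \<bar>y - x\<bar>"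
          using d[of y] by (simp add: bad_def)
        also have "\<dots> \<le> e * \<bar>y - x\<bar>" using n by (intro mult_right_mono) auto
        finally show "norm (F y - F x - (y - x) *\<^sub>R f x) \<le> e * norm (y - x)" by simp
      qed
    qed
    then show "((\<lambda>t. integral {a..t} f) has_vector_derivative f x) (at x within {a..b})"
      by (simp add: F_def[abs_def])
  qed
qed

section \<open>Trajectories as solutions of an integral equation\<close>

lemma AE_lebesgue_on_interval_iff_negligible:
  fixes a b :: real
  shows "(AE t in lebesgue_on {a..b}. P t) \<longleftrightarrow> (\<exists>N. negligible N \<and> (\<forall>t\<in>{a..b} - N. P t))"
proof -
  have "(AE t in lebesgue_on {a..b}. P t) \<longleftrightarrow> (AE t in lebesgue. t \<in> {a..b} \<longrightarrow> P t)"
    by (rule AE_restrict_space_iff) simp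
  also have "\<dots> \<longleftrightarrow> (\<exists>N. negligible N \<and> (\<forall>t\<in>{a..b} - N. P t))"
    unfolding eventually_ae_filter negligible_iff_null_sets
    by (simp add: Bex_def subset_iff Ball_def) blast
  finally show ?thesis .
qed

lemma abs_cont_on_subinterval:
  assumes "abs_cont_on a b f" "a \<le> c" "d \<le> b"
  shows "abs_cont_on c d f"
  unfolding abs_cont_on_def
proof (intro allI impI)
  fix \<epsilon> :: real assume "\<epsilon> > 0"
  then obtain \<delta> where "\<delta> > 0" and \<delta>: "\<And>(I::nat set) l r. \<lbrakk>finite I; \<forall>i\<in>I. a \<le> l i \<and> l i \<le> r i \<and> r i \<le> b;
        disjoint_family_on (\<lambda>i. {l i<..<r i}) I; (\<Sum>i\<in>I. r i - l i) < \<delta>\<rbrakk>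
        \<Longrightarrow> (\<Sum>i\<in>I. norm (f (r i) - f (l i))) < \<epsilon>"
    using assms(1) unfolding abs_cont_on_def by meson
  show "\<exists>\<delta>>0. \<forall>(I::nat set) l r.
        finite I \<longrightarrow>
        (\<forall>i\<in>I. c \<le> l i \<and> l i \<le> r i \<and> r i \<le> d) \<longrightarrow>
        disjoint_family_on (\<lambda>i. {l i<..<r i}) I \<longrightarrow>
        (\<Sum>i\<in>I. r i - l i) < \<delta> \<longrightarrow>
        (\<Sum>i\<in>I. norm (f (r i) - f (l i))) < \<epsilon>"
  proof (intro exI[of _ \<delta>] conjI allI impI \<open>\<delta> > 0\<close>)
    fix I :: "nat set" and l r
    assume "finite I" "\<forall>i\<in>I. c \<le> l i \<and> l i \<le> r i \<and> r i \<le> d"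
      "disjoint_family_on (\<lambda>i. {l i<..<r i}) I" "(\<Sum>i\<in>I. r i - l i) < \<delta>"
    then show "(\<Sum>i\<in>I. norm (f (r i) - f (l i))) < \<epsilon>"
      using assms(2,3) by (intro \<delta>) (auto intro: order_trans)
  qed
qed

lemma abs_cont_on_imp_continuous_on:
  assumes "abs_cont_on a b f"
  shows "continuous_on {a..b} f"
  unfolding continuous_on_iff
proof (intro ballI allI impI)
  fix x \<epsilon> :: real assume x: "x \<in> {a..b}" and "\<epsilon> > 0"
  obtain \<delta> where "\<delta> > 0" and \<delta>: 
      "\<And>(I::nat set) l r. \<lbrakk>finite I; \<And>i. i \<in> I \<Longrightarrow> a \<le> l i \<and> l i \<le> r i \<and> r i \<le> b;
        disjoint_family_on (\<lambda>i. {l i<..<r i}) I; (\<Sum>i\<in>I. r i - l i) < \<delta>\<rbrakk>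
        \<Longrightarrow> (\<Sum>i\<in>I. norm (f (r i) - f (l i))) < \<epsilon>"
    using abs_cont_on_finite_family[OF assms \<open>\<epsilon> > 0\<close>] by blast
  show "\<exists>d>0. \<forall>y\<in>{a..b}. dist y x < d \<longrightarrow> dist (f y) (f x) < \<epsilon>"
  proof (intro exI[of _ \<delta>] conjI ballI impI \<open>\<delta> > 0\<close>)
    fix y assume y: "y \<in> {a..b}" "dist y x < \<delta>"
    have "(\<Sum>i\<in>{0::nat}. norm (f (max x y) - f (min x y))) < \<epsilon>"
      by (rule \<delta>) (use x y in \<open>auto simp: disjoint_family_on_def dist_real_def min_def max_def\<close>)
    then show "dist (f y) (f x) < \<epsilon>"
      by (auto simp: dist_norm min_def max_def norm_minus_commute split: if_splits)
  qed
qed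

lemma lipschitz_imp_abs_cont_on:
  fixes f :: "real \<Rightarrow> 'a::real_normed_vector"
  assumes lip: "\<And>l r. \<lbrakk>a \<le> l; l \<le> r; r \<le> b\<rbrakk> \<Longrightarrow> norm (f r - f l) \<le> C * (r - l)" and "C \<ge> 0"
  shows "abs_cont_on a b f"
  unfolding abs_cont_on_def
proof (intro allI impI)
  fix \<epsilon> :: real assume "\<epsilon> > 0"
  show "\<exists>\<delta>>0. \<forall>(I::nat set) l r.
        finite I \<longrightarrow>
        (\<forall>i\<in>I. a \<le> l i \<and> l i \<le> r i \<and> r i \<le> b) \<longrightarrow>
        disjoint_family_on (\<lambda>i. {l i<..<r i}) I \<longrightarrow>
        (\<Sum>i\<in>I. r i - l i) < \<delta> \<longrightarrow>
        (\<Sum>i\<in>I. norm (f (r i) - f (l i))) < \<epsilon>"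
  proof (intro exI[of _ "\<epsilon> / (C + 1)"] conjI allI impI)
    show "\<epsilon> / (C + 1) > 0" using \<open>\<epsilon> > 0\<close> \<open>C \<ge> 0\<close> by simp
  next
    fix I :: "nat set" and l r
    assume I: "\<forall>i\<in>I. a \<le> l i \<and> l i \<le> r i \<and> r i \<le> b" "(\<Sum>i\<in>I. r i - l i) < \<epsilon> / (C + 1)"
    have "(\<Sum>i\<in>I. norm (f (r i) - f (l i))) \<le> (\<Sum>i\<in>I. C * (r i - l i))"
      by (rule sum_mono) (use I(1) lip in auto)
    also have "\<dots> = C * (\<Sum>i\<in>I. r i - l i)" by (simp add: sum_distrib_left)
    also have "\<dots> \<le> C * (\<epsilon> / (C + 1))"
      using I(2) \<open>C \<ge> 0\<close> by (intro mult_left_mono) auto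
    also have "\<dots> < \<epsilon>" using \<open>\<epsilon> > 0\<close> \<open>C \<ge> 0\<close> by (simp add: field_simps)
    finally show "(\<Sum>i\<in>I. norm (f (r i) - f (l i))) < \<epsilon>" .
  qed
qed

lemma gronwall:
  fixes \<phi> :: "real \<Rightarrow> real"
  assumes cont: "continuous_on {0..T} \<phi>" and "a \<ge> 0"
    and le: "\<And>t. t \<in> {0..T} \<Longrightarrow> \<phi> t \<le> c + a * integral {0..t} \<phi>"
    and t: "t \<in> {0..T}"
  shows "\<phi> t \<le> c * exp (a * t)"
proof -
  define G where "G s = (c + a * integral {0..s} \<phi>) * exp (- a * s)" for s
  have int: "\<phi> integrable_on {0..t}"
    using cont t by (intro integrable_continuous_interval) (auto intro: continuous_on_subset)
  have "G t \<le> G 0"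
  proof (cases "t = 0")
    case False
    show ?thesis
    proof (rule DERIV_nonpos_imp_decreasing_open[of 0 t G])
      show "0 \<le> t" using t by simp
      show "continuous_on {0..t} G" unfolding G_def
        by (intro continuous_intros indefinite_integral_continuous_1 int)
    next
      fix s assume s: "0 < s" "s < t"
      have "((\<lambda>s. integral {0..s} \<phi>) has_real_derivative \<phi> s) (at s within {0..T})"
        by (rule integral_has_real_derivative[OF cont]) (use s t in auto)
      then have I: "((\<lambda>s. integral {0..s} \<phi>) has_real_derivative \<phi> s) (at s)"
        using s t by (simp add: at_within_Icc_at)
      have "(G has_real_derivative a * (\<phi> s - (c + a * integral {0..s} \<phi>)) * exp (- a * s)) (at s)"
        unfolding G_def by (rule derivative_eq_intros I refl)+ (simp add: algebra_simps)
      moreover have "a * (\<phi> s - (c + a * integral {0..s} \<phi>)) * exp (- a * s) \<le> 0"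
        using le[of s] s t \<open>a \<ge> 0\<close> by (intro mult_nonpos_nonneg mult_nonneg_nonpos) auto
      ultimately show "\<exists>y. (G has_real_derivative y) (at s) \<and> y \<le> 0" by blast
    qed
  qed simp
  then have "c + a * integral {0..t} \<phi> \<le> c * exp (a * t)"
    by (simp add: G_def exp_minus field_simps)
  then show ?thesis using le[OF t] by simp
qed

lemma B_inf_AE_norm_le:
  fixes u :: "real \<Rightarrow> real^'m"
  assumes "u \<in> B_inf T"
  shows "AE t in lebesgue_on {0..T}. norm (u t) \<le> CARD('m)"
proof -
  have "AE t in lebesgue_on {0..T}. \<forall>i. \<bar>u t $ i\<bar> \<le> 1"
    using assms unfolding B_inf_def by (simp add: AE_all_countable)
  then show ?thesis
  proof (rule AE_mp, intro AE_I2 impI)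
    fix t assume "\<forall>i. \<bar>u t $ i\<bar> \<le> 1"
    then have "(\<Sum>i\<in>UNIV. \<bar>u t $ i\<bar>) \<le> (\<Sum>i\<in>(UNIV::'m set). 1)" by (intro sum_mono) auto
    then show "norm (u t) \<le> CARD('m)" using norm_le_l1_cart[of "u t"] by simp
  qed
qed

lemma finite_measure_lebesgue_on_interval [simp]:
  fixes a b :: real
  shows "finite_measure (lebesgue_on {a..b})"
  by (rule finite_measure_lebesgue_on) simp

lemma B_inf_integrable:
  assumes "u \<in> B_inf T"
  shows "integrable (lebesgue_on {0..T}) u"
  using assms B_inf_AE_norm_le[OF assms]
  by (intro finite_measure.integrable_const_bound) (auto simp: B_inf_def)

lemma rhs_integrable:
  fixes T :: real and A :: "real^'n^'n" and B :: "real^'m^'n"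
  assumes "integrable (lebesgue_on {0..T}) u" "continuous_on {0..T} x"
  shows "integrable (lebesgue_on {0..T}) (\<lambda>s. A *v x s + B *v u s)"
proof (rule Bochner_Integration.integrable_add)
  show "integrable (lebesgue_on {0..T}) (\<lambda>s. A *v x s)"
    by (rule continuous_imp_integrable_real[OF bounded_linear.continuous_on[OF matrix_vector_mul_bounded_linear assms(2)]])
  show "integrable (lebesgue_on {0..T}) (\<lambda>s. B *v u s)"
    by (rule integrable_bounded_linear[OF _ assms(1)]) simp
qed

text \<open>This lemma and its converse below replace the almost-everywhere differential equation by an
integral equation, a form that passes to limits and to differences of trajectories.\<close>
lemma is_solution_imp_has_integral:
  assumes "is_solution A B T x0 u x" "t \<in> {0..T}"
  shows "((\<lambda>s. A *v x s + B *v u s) has_integral (x t - x0)) {0..t}"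
proof -
  obtain N where N: "negligible N" "\<forall>s\<in>{0..T} - N. (x has_vector_derivative (A *v x s + B *v u s)) (at s within {0..T})"
    using assms(1) unfolding is_solution_def AE_lebesgue_on_interval_iff_negligible by blast
  have "((\<lambda>s. A *v x s + B *v u s) has_integral (x t - x 0)) {0..t}"
  proof (rule abs_cont_on_has_integral[OF _ _ N(1)])
    show "0 \<le> t" using assms by simp
    show "abs_cont_on 0 t x"
      using assms by (auto simp: is_solution_def intro: abs_cont_on_subinterval)
  next
    fix s assume "s \<in> {0..t} - N"
    then show "(x has_vector_derivative (A *v x s + B *v u s)) (at s within {0..t})"
      using N(2) assms(2) by (intro has_vector_derivative_within_subset[where T="{0..t}" and S="{0..T}"]) auto
  qed
  then show ?thesis using assms(1) by (simp add: is_solution_def)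
qed

text \<open>Bounded controls make the right-hand side essentially bounded, so the primitive is Lipschitz and
hence absolutely continuous; differentiability almost everywhere is Lebesgue's theorem.\<close>
lemma has_integral_imp_is_solution:
  fixes A :: "real^'n^'n" and B :: "real^'m^'n"
  assumes u: "u \<in> B_inf T" and x: "continuous_on {0..T} x" and "T > 0"
    and eq: "\<And>t. t \<in> {0..T} \<Longrightarrow> ((\<lambda>s. A *v x s + B *v u s) has_integral (x t - x0)) {0..t}"
  shows "is_solution A B T x0 u x"
  unfolding is_solution_def
proof (intro conjI)
  let ?g = "\<lambda>s. A *v x s + B *v u s"
  have int: "?g integrable_on {0..T}" using eq[of T] \<open>T > 0\<close> by (auto simp: integrable_on_def)
  show "x 0 = x0"
    using has_integral_unique[OF eq[of 0], of 0] has_integral_refl(2)[of ?g 0] \<open>T > 0\<close> by simp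
  obtain C where C: "C \<ge> 0" "AE s in lebesgue_on {0..T}. norm (?g s) \<le> C"
  proof -
    have "compact (x ` {0..T})" using x by (intro compact_continuous_image) auto
    then obtain R where R: "\<And>s. s \<in> {0..T} \<Longrightarrow> norm (x s) \<le> R"
      using compact_imp_bounded bounded_iff by (metis image_eqI)
    then have "R \<ge> 0" using \<open>T > 0\<close> by (meson atLeastAtMost_iff less_imp_le norm_ge_zero order_refl order_trans)
    have "AE s in lebesgue_on {0..T}. norm (?g s) \<le> onorm ((*v) A) * R + onorm ((*v) B) * CARD('m)"
      using B_inf_AE_norm_le[OF u]
    proof (rule AE_mp, intro AE_I2 impI)
      fix s assume "s \<in> space (lebesgue_on {0..T})" and us: "norm (u s) \<le> CARD('m)"
      then have xs: "norm (x s) \<le> R" using R by simp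
      have "norm (?g s) \<le> norm (A *v x s) + norm (B *v u s)" by (rule norm_triangle_ineq)
      also have "\<dots> \<le> onorm ((*v) A) * norm (x s) + onorm ((*v) B) * norm (u s)"
        by (intro add_mono onorm) simp_all
      also have "\<dots> \<le> onorm ((*v) A) * R + onorm ((*v) B) * CARD('m)"
        using us xs by (intro add_mono mult_left_mono onorm_pos_le) simp_all
      finally show "norm (?g s) \<le> onorm ((*v) A) * R + onorm ((*v) B) * CARD('m)" .
    qed
    moreover have "0 \<le> onorm ((*v) A) * R + onorm ((*v) B) * CARD('m)"
      using \<open>R \<ge> 0\<close> by (intro add_nonneg_nonneg mult_nonneg_nonneg onorm_pos_le) simp_all
    ultimately show ?thesis using that by blast
  qed
  obtain N where N: "negligible N" "\<forall>s\<in>{0..T} - N. norm (?g s) \<le> C"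
    using C(2) unfolding AE_lebesgue_on_interval_iff_negligible by blast
  show "abs_cont_on 0 T x"
  proof (rule lipschitz_imp_abs_cont_on[OF _ C(1)])
    fix l r assume lr: "0 \<le> l" "l \<le> r" "r \<le> T"
    have "?g integrable_on {0..r}" using eq[of r] lr by (auto simp: integrable_on_def)
    moreover have "integral {0..l} ?g = x l - x0" "integral {0..r} ?g = x r - x0"
      using eq lr by (auto intro!: integral_unique)
    moreover have "integral {0..l} ?g + integral {l..r} ?g = integral {0..r} ?g"
      by (rule Henstock_Kurzweil_Integration.integral_combine) (use lr calculation(1) in auto)
    ultimately have "x l - x0 + integral {l..r} ?g = x r - x0" by (simp only:)
    then have I: "integral {l..r} ?g = x r - x l"
      by (simp add: diff_add_eq eq_diff_eq add.commute[of "x l"])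
    have I2: "?g integrable_on {l..r}"
      by (rule integrable_on_subinterval[OF \<open>?g integrable_on {0..r}\<close>]) (use lr in auto)
    have "((\<lambda>s. if s \<in> N then 0 else ?g s) has_integral (x r - x l)) {l..r}"
      by (rule has_integral_spike[OF N(1), where f="?g"]) (use I I2 in \<open>auto simp: has_integral_integrable_integral\<close>)
    then have "norm (x r - x l) \<le> C * measure lborel (cbox l r)"
      by (intro has_integral_bound[of C "\<lambda>s. if s \<in> N then 0 else ?g s"]) (use N lr C in auto)
    then show "norm (x r - x l) \<le> C * (r - l)" using lr by simp
  qed
  obtain M where M: "negligible M"
    "\<And>t. t \<in> {0..T} - M \<Longrightarrow> ((\<lambda>t. integral {0..t} ?g) has_vector_derivative ?g t) (at t within {0..T})"
    using lebesgue_differentiation_interval[OF int] by blast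
  have "(x has_vector_derivative ?g t) (at t within {0..T})" if t: "t \<in> {0..T} - M" for t
  proof -
    have "((\<lambda>t. x0 + integral {0..t} ?g) has_vector_derivative ?g t) (at t within {0..T})"
      using M(2)[OF t] has_vector_derivative_add[OF has_vector_derivative_const] by fastforce
    moreover have "x0 + integral {0..s} ?g = x s" if "s \<in> {0..T}" for s
      using integral_unique[OF eq[OF that]] by simp
    ultimately show ?thesis
      by (metis (no_types, lifting) DiffD1 has_vector_derivative_transform t)
  qed
  then show "AE t in lebesgue_on {0..T}. (x has_vector_derivative ?g t) (at t within {0..T})"
    unfolding AE_lebesgue_on_interval_iff_negligible using M(1) by blast
qed

lemma is_solution_continuous_on:
  "is_solution A B T x0 u x \<Longrightarrow> continuous_on {0..T} x"
  by (simp add: is_solution_def abs_cont_on_imp_continuous_on)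

text \<open>Gronwall's inequality for the difference of two trajectories. With \<open>u = v\<close> it gives
uniqueness of the trajectory, and for a sequence of controls converging in \<open>L\<^sup>1\<close> it gives
uniform convergence of the trajectories.\<close>
lemma solution_stability:
  fixes A :: "real^'n^'n" and B :: "real^'m^'n"
  assumes u: "u \<in> B_inf T" and v: "v \<in> B_inf T" and x: "is_solution A B T x0 u x"
    and y: "is_solution A B T x0 v y" and t: "t \<in> {0..T}"
  shows "norm (x t - y t)
    \<le> onorm ((*v) B) * exp (onorm ((*v) A) * T) * (\<integral>s. norm (u s - v s) \<partial>lebesgue_on {0..T})"
proof -
  let ?a = "onorm ((*v) A)" and ?b = "onorm ((*v) B)"
  have a: "?a \<ge> 0" and b: "?b \<ge> 0" by (intro onorm_pos_le; simp)+
  define D where "D = (\<integral>s. norm (u s - v s) \<partial>lebesgue_on {0..T})"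
  have D: "D \<ge> 0" by (simp add: D_def)
  have int: "integrable (lebesgue_on {0..T}) (\<lambda>s. norm (u s - v s))"
    using u v by (intro integrable_norm Bochner_Integration.integrable_diff B_inf_integrable)
  then have intH: "(\<lambda>s. norm (u s - v s)) integrable_on {0..T}"
    by (intro integrable_on_lebesgue_on) auto
  have DH: "D = integral {0..T} (\<lambda>s. norm (u s - v s))"
    using int unfolding D_def by (intro lebesgue_integral_eq_integral) auto
  have c: "continuous_on {0..T} (\<lambda>s. norm (x s - y s))"
    using x y by (intro continuous_intros is_solution_continuous_on)
  have "norm (x t - y t) \<le> (?b * D) * exp (?a * t)"
  proof (rule gronwall[OF c a _ t])
    fix r assume r: "r \<in> {0..T}"
    let ?h = "\<lambda>s. A *v (x s - y s) + B *v (u s - v s)"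
    have "((\<lambda>s. (A *v x s + B *v u s) - (A *v y s + B *v v s)) has_integral ((x r - x0) - (y r - x0))) {0..r}"
      by (intro has_integral_diff is_solution_imp_has_integral[OF _ r] x y)
    then have h: "(?h has_integral (x r - y r)) {0..r}"
      by (simp add: matrix_vector_mult_diff_distrib algebra_simps)
    have i1: "(\<lambda>s. norm (x s - y s)) integrable_on {0..r}"
      using c r by (intro integrable_continuous_interval) (auto intro: continuous_on_subset)
    have i2: "(\<lambda>s. norm (u s - v s)) integrable_on {0..r}"
      using intH r by (auto intro: integrable_on_subinterval)
    have "norm (x r - y r) = norm (integral {0..r} ?h)" using h by (simp add: integral_unique)
    also have "\<dots> \<le> integral {0..r} (\<lambda>s. ?a * norm (x s - y s) + ?b * norm (u s - v s))"
    proof (rule integral_norm_bound_integral)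
      show "?h integrable_on {0..r}" using h by blast
      show "(\<lambda>s. ?a * norm (x s - y s) + ?b * norm (u s - v s)) integrable_on {0..r}"
        using i1 i2 by (intro integrable_add integrable_on_mult_right)
      fix s
      have "norm (?h s) \<le> norm (A *v (x s - y s)) + norm (B *v (u s - v s))" by (rule norm_triangle_ineq)
      also have "\<dots> \<le> ?a * norm (x s - y s) + ?b * norm (u s - v s)"
        by (intro add_mono onorm) simp_all
      finally show "norm (?h s) \<le> ?a * norm (x s - y s) + ?b * norm (u s - v s)" .
    qed
    also have "\<dots> = ?a * integral {0..r} (\<lambda>s. norm (x s - y s)) + ?b * integral {0..r} (\<lambda>s. norm (u s - v s))"
      using i1 i2 by (simp add: integral_add integrable_on_mult_right)
    also have "integral {0..r} (\<lambda>s. norm (u s - v s)) \<le> D"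
      unfolding DH using r i2 intH by (intro integral_subset_le) auto
    finally show "norm (x r - y r) \<le> ?b * D + ?a * integral {0..r} (\<lambda>s. norm (x s - y s))"
      using b by (simp add: mult_left_mono)
  qed
  also have "\<dots> \<le> (?b * D) * exp (?a * T)"
    using a b D t by (intro mult_left_mono) (auto simp: mult_left_mono)
  finally show ?thesis
    by (simp add: D_def mult_ac)
qed

section \<open>Selecting a convergent minimizing sequence\<close>

lemma is_norm_le_norm:
  fixes N :: "'a::euclidean_space \<Rightarrow> real"
  assumes N: "is_norm N"
  obtains C where "C \<ge> 0" "\<And>v. N v \<le> C * norm v"
proof
  have tri: "N (v + w) \<le> N v + N w" and zero: "N 0 = 0" and nn: "0 \<le> N v"
    and sc: "N (c *\<^sub>R v) = \<bar>c\<bar> * N v" for c v w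
    using N by (auto simp: is_norm_def)
  have sum: "N (sum f S) \<le> (\<Sum>i\<in>S. N (f i))" if "finite S" for f :: "'a \<Rightarrow> 'a" and S
    using that by induction (auto simp: zero intro: order_trans[OF tri])
  show "(\<Sum>b\<in>Basis. N b) \<ge> 0" using nn by (intro sum_nonneg)
  fix v
  have "N v = N (\<Sum>b\<in>Basis. (v \<bullet> b) *\<^sub>R b)" by (simp add: euclidean_representation)
  also have "\<dots> \<le> (\<Sum>b\<in>Basis. N ((v \<bullet> b) *\<^sub>R b))" by (rule sum) simp
  also have "\<dots> \<le> (\<Sum>b\<in>Basis. norm v * N b)"
    unfolding sc by (intro sum_mono mult_right_mono Basis_le_norm nn)
  finally show "N v \<le> (\<Sum>b\<in>Basis. N b) * norm v"
    by (simp add: sum_distrib_left mult.commute)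
qed

lemma is_norm_continuous_on:
  fixes N :: "'a::euclidean_space \<Rightarrow> real"
  assumes N: "is_norm N"
  shows "continuous_on UNIV N"
proof -
  obtain C where C: "C \<ge> 0" "\<And>v. N v \<le> C * norm v" using is_norm_le_norm[OF N] by blast
  have tri: "N (v + w) \<le> N v + N w" and sc: "N ((-1) *\<^sub>R v) = \<bar>-1\<bar> * N v" for v w
    using N unfolding is_norm_def by blast+
  have minus: "N (- v) = N v" for v using sc[of v] by simp
  have "dist (N v) (N w) \<le> C * dist v w" for v w
  proof -
    have "N v \<le> N w + N (v - w)" "N w \<le> N v + N (v - w)"
      using tri[of w "v - w"] tri[of v "w - v"] minus[of "v - w"] by simp_all
    then show ?thesis using C(2)[of "v - w"] by (simp add: dist_norm abs_le_iff)
  qed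
  then have "C-lipschitz_on UNIV N" using C(1) by (intro lipschitz_onI)
  then show ?thesis by (rule lipschitz_on_continuous_on)
qed

text \<open>This takes the place of weak compactness. Think of \<open>q\<close> as a squared Hilbert norm and of
\<open>D\<close> as the squared distance, so that the last assumption on midpoints is the parallelogram
law. The sublevel sets \<open>F k\<close> of \<open>f\<close> are closed under midpoints and shrink
with \<open>k\<close>, so the infima \<open>I k\<close> of \<open>q\<close> over them increase to a
finite limit. Almost minimizers \<open>w k\<close> of \<open>q\<close> on \<open>F k\<close> are then
close to each other, because the midpoint of two of them cannot have a value of \<open>q\<close> much
below theirs. A subsequence makes consecutive distances as small as prescribed.\<close>
lemma near_minimizers_fast_sequence:
  fixes f q :: "'a \<Rightarrow> real" and D :: "'a \<Rightarrow> 'a \<Rightarrow> real"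
  assumes ne: "S \<noteq> {}" and f: "\<And>u. u \<in> S \<Longrightarrow> c \<le> f u"
    and q: "\<And>u. u \<in> S \<Longrightarrow> b \<le> q u" "\<And>u. u \<in> S \<Longrightarrow> q u \<le> M"
    and mid: "\<And>u v. \<lbrakk>u \<in> S; v \<in> S\<rbrakk> \<Longrightarrow> mid u v \<in> S"
      "\<And>u v. \<lbrakk>u \<in> S; v \<in> S\<rbrakk> \<Longrightarrow> f (mid u v) \<le> max (f u) (f v)"
      "\<And>u v. \<lbrakk>u \<in> S; v \<in> S\<rbrakk> \<Longrightarrow> D u v \<le> 2 * q u + 2 * q v - 4 * q (mid u v)"
    and \<epsilon>: "\<And>k::nat. \<epsilon> k > 0"
  obtains w :: "nat \<Rightarrow> 'a" where "\<And>k. w k \<in> S"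
    "\<And>k u. u \<in> S \<Longrightarrow> f (w k) \<le> f u + inverse (real (Suc k))"
    "\<And>k. D (w k) (w (Suc k)) \<le> \<epsilon> k"
proof -
  define m where "m = (INF u\<in>S. f u)"
  have m: "m \<le> f u" if "u \<in> S" for u
    unfolding m_def by (rule cINF_lower[OF _ that]) (use f in \<open>auto simp: bdd_below_def\<close>)
  define F where "F k = {u \<in> S. f u \<le> m + inverse (real (Suc k))}" for k :: nat
  have F_ne: "F k \<noteq> {}" for k
  proof -
    have "\<exists>u\<in>S. f u < m + inverse (real (Suc k))"
      unfolding m_def by (subst cINF_less_iff[symmetric, OF ne]) (use f in \<open>auto simp: bdd_below_def\<close>)
    then show ?thesis by (auto simp: F_def intro: less_imp_le)
  qed
  have F_anti: "F l \<subseteq> F k" if "k \<le> l" for k l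
  proof -
    have le: "inverse (real (Suc l)) \<le> inverse (real (Suc k))" using that by (intro le_imp_inverse_le) auto
    show ?thesis unfolding F_def by (blast intro: order_trans[OF _ add_left_mono[OF le]])
  qed
  define I where "I k = (INF u\<in>F k. q u)" for k
  have bdd: "bdd_below (q ` F k)" for k using q(1) by (auto simp: bdd_below_def F_def)
  have I_le: "I k \<le> q u" if "u \<in> F k" for k u
    unfolding I_def by (rule cINF_lower[OF bdd that])
  have I_mono: "I k \<le> I l" if "k \<le> l" for k l
    unfolding I_def by (rule cINF_superset_mono[OF F_ne bdd F_anti[OF that]]) simp
  have I_M: "I k \<le> M" for k
    using F_ne[of k] I_le[of _ k] q(2) by (auto simp: F_def intro: order_trans)
  have "\<exists>u\<in>F k. q u < I k + inverse (real (Suc k))" for k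
    unfolding I_def by (subst cINF_less_iff[symmetric, OF F_ne bdd]) simp
  then obtain w where w: "\<And>k. w k \<in> F k" "\<And>k. q (w k) < I k + inverse (real (Suc k))" by metis
  have wS: "w k \<in> S" for k using w(1)[of k] by (simp add: F_def)
  have D: "D (w k) (w l) \<le> 2 * \<bar>I l - I k\<bar> + 4 * inverse (real (Suc p))" if "p \<le> k" "p \<le> l" for k l p
  proof -
    have "mid (w k) (w l) \<in> F (min k l)"
      using subsetD[OF F_anti w(1)[of k], of "min k l"] subsetD[OF F_anti w(1)[of l], of "min k l"]
        mid(1,2)[OF wS[of k] wS[of l]]
      by (auto simp: F_def)
    then have 1: "I (min k l) \<le> q (mid (w k) (w l))" by (rule I_le)
    have 2: "2 * I (min k l) = I k + I l - \<bar>I l - I k\<bar>"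
      using I_mono[of k l] I_mono[of l k] by (cases "k \<le> l") (auto simp: min_def)
    have "q (w i) < I i + inverse (real (Suc p))" if "p \<le> i" for i
      by (rule less_le_trans[OF w(2) add_left_mono[OF le_imp_inverse_le]]) (use that in simp_all)
    then have 3: "q (w k) < I k + inverse (real (Suc p))" "q (w l) < I l + inverse (real (Suc p))"
      using that by blast+
    have arith: "d \<le> 2 * c + 4 * e" if "i \<le> r" "2 * i = x + y - c" "s < x + e" "t < y + e"
      "d \<le> 2 * s + 2 * t - 4 * r" for d c e i r x y s t :: real
      using that by linarith
    show ?thesis by (rule arith[OF 1 2 3 mid(3)[OF wS wS]])
  qed
  have "incseq I" by (rule incseq_SucI) (simp add: I_mono)
  then have "Cauchy I" using incseq_convergent[of I M] I_M by (metis LIMSEQ_imp_Cauchy)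
  have "\<exists>P. \<forall>k\<ge>P. \<forall>l\<ge>P. D (w k) (w l) \<le> \<epsilon> j" for j
  proof -
    obtain P1 where P1: "\<And>k l. \<lbrakk>k \<ge> P1; l \<ge> P1\<rbrakk> \<Longrightarrow> \<bar>I l - I k\<bar> < \<epsilon> j / 4"
      using CauchyD[OF \<open>Cauchy I\<close>, of "\<epsilon> j / 4"] \<epsilon>[of j] by (auto simp: real_norm_def)
    obtain P2 where P2: "inverse (real (Suc P2)) < \<epsilon> j / 8"
      using reals_Archimedean[of "\<epsilon> j / 8"] \<epsilon>[of j] by auto
    show ?thesis
    proof (intro exI[of _ "max P1 P2"] allI impI)
      fix k l assume "max P1 P2 \<le> k" "max P1 P2 \<le> l"
      then show "D (w k) (w l) \<le> \<epsilon> j"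
        using D[of P2 k l] P1[of k l] P2 by simp
    qed
  qed
  then obtain P where P: "\<And>j k l. \<lbrakk>k \<ge> P j; l \<ge> P j\<rbrakk> \<Longrightarrow> D (w k) (w l) \<le> \<epsilon> j" by metis
  \<comment> \<open>the partial sums make the chosen indices nondecreasing and at least both the threshold and the position\<close>
  define r where "r k = k + (\<Sum>j\<le>k. P j)" for k
  have r: "k \<le> r k" "P k \<le> r k" "r k \<le> r (Suc k)" for k
    using member_le_sum[of k "{..k}" P] by (simp_all add: r_def)
  show thesis
  proof
    show "w (r k) \<in> S" for k by (rule wS)
    show "f (w (r k)) \<le> f u + inverse (real (Suc k))" if "u \<in> S" for k u
    proof -
      have "w (r k) \<in> F k" by (rule subsetD[OF F_anti[OF r(1)] w(1)])
      then have "f (w (r k)) \<le> m + inverse (real (Suc k))" unfolding F_def by blast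
      then show ?thesis using add_right_mono[OF m[OF that]] by (rule order_trans)
    qed
    show "D (w (r k)) (w (r (Suc k))) \<le> \<epsilon> k" for k
      by (rule P[OF r(2) order_trans[OF r(2,3)]])
  qed
qed

text \<open>On a finite measure space square-integral distances of geometric size make the series of
consecutive distances integrable, hence finite almost everywhere, so that it converges absolutely.\<close>
lemma AE_convergent_L2_fast:
  fixes f :: "nat \<Rightarrow> 'a \<Rightarrow> 'b::{banach, second_countable_topology}"
  assumes fin: "finite_measure M" and meas: "\<And>k. f k \<in> borel_measurable M"
    and int: "\<And>k. integrable M (\<lambda>x. (norm (f k x - f (Suc k) x))\<^sup>2)"
    and le: "\<And>k. (\<integral>x. (norm (f k x - f (Suc k) x))\<^sup>2 \<partial>M) \<le> (1/4)^k"
  shows "AE x in M. convergent (\<lambda>k. f k x)"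
proof -
  interpret finite_measure M by fact
  note [measurable] = meas
  define d where "d k x = norm (f k x - f (Suc k) x)" for k x
  have [measurable]: "d k \<in> borel_measurable M" for k unfolding d_def by measurable
  have d0: "0 \<le> d k x" for k x by (simp add: d_def)
  define C where "C = (measure M (space M) + 1) / 2"
  have bound: "(\<integral>\<^sup>+ x. ennreal (d k x) \<partial>M) \<le> ennreal (C * (1/2)^k)" for k
  proof -
    let ?s = "(1/2::real)^k"
    have int2: "integrable M (\<lambda>x. (?s + 2^k * (d k x)\<^sup>2) / 2)"
      using int[of k] by (simp add: d_def)
    \<comment> \<open>arithmetic-geometric mean inequality, weighted so that both terms become summable in k\<close>
    have "(\<integral>\<^sup>+ x. ennreal (d k x) \<partial>M) \<le> (\<integral>\<^sup>+ x. ennreal ((?s + 2^k * (d k x)\<^sup>2) / 2) \<partial>M)"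
    proof (intro nn_integral_mono ennreal_leI)
      fix x
      have "0 \<le> 2^k * (?s - d k x)\<^sup>2" by simp
      also have "\<dots> = ?s - 2 * d k x + 2^k * (d k x)\<^sup>2"
        by (simp add: power2_eq_square algebra_simps power_one_over)
      finally show "d k x \<le> (?s + 2^k * (d k x)\<^sup>2) / 2" by simp
    qed
    also have "\<dots> = ennreal (\<integral>x. (?s + 2^k * (d k x)\<^sup>2) / 2 \<partial>M)"
      by (rule nn_integral_eq_integral[OF int2]) simp
    also have "\<dots> \<le> ennreal (C * ?s)"
    proof (rule ennreal_leI)
      have "(\<integral>x. (?s + 2^k * (d k x)\<^sup>2) / 2 \<partial>M) = (measure M (space M) * ?s + 2^k * (\<integral>x. (d k x)\<^sup>2 \<partial>M)) / 2"
        using int[of k] by (simp add: d_def)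
      also have "\<dots> \<le> (measure M (space M) * ?s + 2^k * (1/4)^k) / 2"
        using le[of k] by (simp add: d_def)
      also have "(2::real)^k * (1/4)^k = ?s" by (simp flip: power_mult_distrib)
      finally show "(\<integral>x. (?s + 2^k * (d k x)\<^sup>2) / 2 \<partial>M) \<le> C * ?s"
        by (simp add: C_def field_simps)
    qed
    finally show ?thesis .
  qed
  have "(\<integral>\<^sup>+ x. (\<Sum>k. ennreal (d k x)) \<partial>M) = (\<Sum>k. \<integral>\<^sup>+ x. ennreal (d k x) \<partial>M)"
    by (rule nn_integral_suminf) measurable
  also have "\<dots> \<le> (\<Sum>k. ennreal (C * (1/2)^k))"
    by (intro suminf_le bound) auto
  also have "\<dots> = ennreal (\<Sum>k. C * (1/2)^k)"
    by (rule suminf_ennreal2) (auto simp: C_def intro!: summable_mult summable_geometric)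
  finally have "(\<integral>\<^sup>+ x. (\<Sum>k. ennreal (d k x)) \<partial>M) \<noteq> \<infinity>"
    by (auto simp: top_unique)
  then have "AE x in M. (\<Sum>k. ennreal (d k x)) \<noteq> \<infinity>"
    by (rule nn_integral_PInf_AE[rotated]) measurable
  then show ?thesis
  proof (rule AE_mp, intro AE_I2 impI)
    fix x assume "(\<Sum>k. ennreal (d k x)) \<noteq> \<infinity>"
    then have "summable (\<lambda>k. d k x)" using d0 by (intro summable_suminf_not_top) auto
    then have "summable (\<lambda>k. norm (f (Suc k) x - f k x))"
      by (simp add: d_def norm_minus_commute)
    then have "convergent (\<lambda>n. \<Sum>k<n. f (Suc k) x - f k x)"
      by (simp add: summable_norm_cancel flip: summable_iff_convergent)
    then have "convergent (\<lambda>n. f n x - f 0 x)"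
      unfolding sum_lessThan_telescope[of "\<lambda>k. f k x"] .
    then have "convergent (\<lambda>n. (f n x - f 0 x) + f 0 x)" by (intro convergent_add convergent_const)
    then show "convergent (\<lambda>k. f k x)" by simp
  qed
qed

section \<open>Convexity of the control problem\<close>

lemma B_inf_subset_L1_controls:
  assumes "is_norm N"
  shows "B_inf T \<subseteq> L1_controls N T"
proof
  fix u :: "real \<Rightarrow> real^'a" assume u: "u \<in> B_inf T"
  then have [measurable]: "u \<in> borel_measurable (lebesgue_on {0..T})" by (simp add: B_inf_def)
  have [measurable]: "N \<in> borel_measurable borel"
    using is_norm_continuous_on[OF assms] by (rule borel_measurable_continuous_onI)
  obtain C where C: "C \<ge> 0" "\<And>v. N v \<le> C * norm v" using is_norm_le_norm[OF assms] by blast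
  have "integrable (lebesgue_on {0..T}) (\<lambda>t. N (u t))"
  proof (rule Bochner_Integration.integrable_bound)
    show "integrable (lebesgue_on {0..T}) (\<lambda>t. C * norm (u t))"
      using B_inf_integrable[OF u] by simp
    show "AE t in lebesgue_on {0..T}. norm (N (u t)) \<le> norm (C * norm (u t))"
      using C assms by (auto simp: is_norm_def)
  qed measurable
  then show "u \<in> L1_controls N T" by (simp add: L1_controls_def)
qed

text \<open>The functional \<open>J\<close> refers to a chosen trajectory; by uniqueness the choice does not matter,
so any known trajectory may be used to compute it.\<close>
lemma state_eq:
  assumes "u \<in> B_inf T" "is_solution A B T x0 u x" "t \<in> {0..T}"
  shows "state A B T x0 u t = x t"
proof -
  have "is_solution A B T x0 u (state A B T x0 u)"
    unfolding state_def by (rule someI[of "is_solution A B T x0 u", OF assms(2)])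
  then show ?thesis using solution_stability[OF assms(1,1) _ assms(2,3)] by fastforce
qed

lemma J_eq:
  assumes "u \<in> B_inf T" "is_solution A B T x0 u x"
  shows "J A B Q N T x0 u = (\<integral>t. (x t \<bullet> (Q *v x t) + N (u t)) \<partial>lebesgue_on {0..T})"
  unfolding J_def Let_def
  by (rule Bochner_Integration.integral_cong) (auto simp: state_eq[OF assms])

lemma cost_integrable:
  fixes Q :: "real^'n^'n"
  assumes "is_norm N" "u \<in> B_inf T" "continuous_on {0..T} x"
  shows "integrable (lebesgue_on {0..T}) (\<lambda>t. x t \<bullet> (Q *v x t) + N (u t))"
proof (rule Bochner_Integration.integrable_add)
  have "continuous_on {0..T} (\<lambda>t. Q *v x t)"
    by (rule bounded_linear.continuous_on[OF matrix_vector_mul_bounded_linear assms(3)])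
  then show "integrable (lebesgue_on {0..T}) (\<lambda>t. x t \<bullet> (Q *v x t))"
    by (intro continuous_imp_integrable_real continuous_on_inner assms(3))
  show "integrable (lebesgue_on {0..T}) (\<lambda>t. N (u t))"
    using B_inf_subset_L1_controls[OF assms(1)] assms(2) by (auto simp: L1_controls_def)
qed

definition midpoint_control :: "(real \<Rightarrow> 'a::real_vector) \<Rightarrow> (real \<Rightarrow> 'a) \<Rightarrow> real \<Rightarrow> 'a" where
  "midpoint_control u v t = (1/2) *\<^sub>R (u t + v t)"

lemma B_inf_midpoint:
  assumes "u \<in> B_inf T" "v \<in> B_inf T"
  shows "midpoint_control u v \<in> B_inf T"
proof -
  have "midpoint_control u v \<in> borel_measurable (lebesgue_on {0..T})"
    using assms unfolding B_inf_def midpoint_control_def[abs_def]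
    by (intro borel_measurable_scaleR borel_measurable_add) auto
  moreover have "AE t in lebesgue_on {0..T}. \<bar>midpoint_control u v t $ i\<bar> \<le> 1" for i
  proof -
    have "AE t in lebesgue_on {0..T}. \<bar>u t $ i\<bar> \<le> 1" "AE t in lebesgue_on {0..T}. \<bar>v t $ i\<bar> \<le> 1"
      using assms by (auto simp: B_inf_def)
    then show ?thesis by eventually_elim (auto simp: midpoint_control_def)
  qed
  ultimately show ?thesis by (simp add: B_inf_def)
qed

lemma is_solution_midpoint:
  fixes A :: "real^'n^'n" and B :: "real^'m^'n"
  assumes "T > 0" "u \<in> B_inf T" "v \<in> B_inf T" "is_solution A B T x0 u x" "is_solution A B T x0 v y"
  shows "is_solution A B T x0 (midpoint_control u v) (midpoint_control x y)"
proof (rule has_integral_imp_is_solution)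
  show "continuous_on {0..T} (midpoint_control x y)"
    unfolding midpoint_control_def using assms by (intro continuous_intros is_solution_continuous_on)
  fix t assume t: "t \<in> {0..T}"
  have "((\<lambda>s. (1/2) *\<^sub>R ((A *v x s + B *v u s) + (A *v y s + B *v v s))) has_integral 
      (1/2) *\<^sub>R ((x t - x0) + (y t - x0))) {0..t}"
    by (intro has_integral_cmul has_integral_add is_solution_imp_has_integral[OF _ t] assms)
  moreover have "(1/2) *\<^sub>R ((x t - x0) + (y t - x0)) = midpoint_control x y t - x0"
    by (simp add: midpoint_control_def vec_eq_iff field_simps)
  moreover have "(1/2) *\<^sub>R ((A *v x s + B *v u s) + (A *v y s + B *v v s))
      = A *v midpoint_control x y s + B *v midpoint_control u v s" for s
    by (simp add: midpoint_control_def matrix_vector_mult_scaleR matrix_vector_right_distrib algebra_simps)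
  ultimately show "((\<lambda>s. A *v midpoint_control x y s + B *v midpoint_control u v s)
      has_integral (midpoint_control x y t - x0)) {0..t}"
    by simp
qed (use assms in \<open>auto intro: B_inf_midpoint\<close>)

text \<open>The difference of the two sides is a quarter of the quadratic form at \<open>x - y\<close>.\<close>
lemma nonneg_definite_midpoint:
  assumes "nonneg_definite Q"
  shows "((1/2) *\<^sub>R (x + y)) \<bullet> (Q *v ((1/2) *\<^sub>R (x + y))) \<le> (x \<bullet> (Q *v x) + y \<bullet> (Q *v y)) / 2"
proof -
  have "0 \<le> (x - y) \<bullet> (Q *v (x - y))" using assms by (simp add: nonneg_definite_def)
  then show ?thesis
    by (simp add: matrix_vector_mult_scaleR matrix_vector_right_distrib matrix_vector_mult_diff_distrib
        inner_add_left inner_add_right inner_diff_left inner_diff_right field_simps)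
qed

lemma J_midpoint:
  fixes A :: "real^'n^'n" and B :: "real^'m^'n"
  assumes N: "is_norm N" and Q: "nonneg_definite Q" and "T > 0"
    and u: "u \<in> B_inf T" "is_solution A B T x0 u x" and v: "v \<in> B_inf T" "is_solution A B T x0 v y"
  shows "J A B Q N T x0 (midpoint_control u v) \<le> (J A B Q N T x0 u + J A B Q N T x0 v) / 2"
proof -
  note c = is_solution_continuous_on
  let ?M = "lebesgue_on {0..T}"
  let ?x = "midpoint_control x y" and ?u = "midpoint_control u v"
  note mid = B_inf_midpoint[OF u(1) v(1)] is_solution_midpoint[OF \<open>T > 0\<close> u(1) v(1) u(2) v(2)]
  note i = cost_integrable[OF N u(1) c[OF u(2)], of Q] cost_integrable[OF N v(1) c[OF v(2)], of Q]
  have "J A B Q N T x0 ?u = (\<integral>t. (?x t \<bullet> (Q *v ?x t) + N (?u t)) \<partial>?M)"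
    by (rule J_eq[OF mid])
  also have "\<dots> \<le> (\<integral>t. ((x t \<bullet> (Q *v x t) + N (u t)) + (y t \<bullet> (Q *v y t) + N (v t))) / 2 \<partial>?M)"
  proof (rule integral_mono)
    show "integrable ?M (\<lambda>t. ?x t \<bullet> (Q *v ?x t) + N (?u t))"
      by (rule cost_integrable[OF N mid(1) c[OF mid(2)]])
    show "integrable ?M (\<lambda>t. ((x t \<bullet> (Q *v x t) + N (u t)) + (y t \<bullet> (Q *v y t) + N (v t))) / 2)"
      using i by simp
    fix t
    have "N ((1/2) *\<^sub>R (u t + v t)) = 1/2 * N (u t + v t)" "N (u t + v t) \<le> N (u t) + N (v t)"
      using N by (simp_all add: is_norm_def)
    then have "N (?u t) \<le> (N (u t) + N (v t)) / 2" unfolding midpoint_control_def by simp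
    moreover have "?x t \<bullet> (Q *v ?x t) \<le> (x t \<bullet> (Q *v x t) + y t \<bullet> (Q *v y t)) / 2"
      unfolding midpoint_control_def by (rule nonneg_definite_midpoint[OF Q])
    ultimately show "?x t \<bullet> (Q *v ?x t) + N (?u t) \<le> ((x t \<bullet> (Q *v x t) + N (u t)) + (y t \<bullet> (Q *v y t) + N (v t))) / 2"
      by (simp add: field_simps)
  qed
  also have "\<dots> = (J A B Q N T x0 u + J A B Q N T x0 v) / 2"
    using i by (simp add: J_eq[OF u] J_eq[OF v])
  finally show ?thesis .
qed

lemma B_inf_square_integrable:
  fixes u v :: "real \<Rightarrow> real^'m"
  assumes u: "u \<in> B_inf T" and v: "v \<in> B_inf T"
  shows "integrable (lebesgue_on {0..T}) (\<lambda>t. u t \<bullet> v t)"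
proof (rule finite_measure.integrable_const_bound)
  show "AE t in lebesgue_on {0..T}. norm (u t \<bullet> v t) \<le> real CARD('m) * real CARD('m)"
    using B_inf_AE_norm_le[OF u] B_inf_AE_norm_le[OF v]
  proof eventually_elim
    case (elim t)
    then have "norm (u t) * norm (v t) \<le> real CARD('m) * real CARD('m)" by (intro mult_mono) auto
    then show ?case using Cauchy_Schwarz_ineq2[of "u t" "v t"] by simp
  qed
  show "(\<lambda>t. u t \<bullet> v t) \<in> borel_measurable (lebesgue_on {0..T})"
    using u v by (intro borel_measurable_inner) (auto simp: B_inf_def)
qed simp

lemma B_inf_L2_bound:
  fixes u :: "real \<Rightarrow> real^'m"
  assumes u: "u \<in> B_inf T" and "T > 0"
  shows "(\<integral>t. (norm (u t))\<^sup>2 \<partial>lebesgue_on {0..T}) \<le> (real CARD('m))\<^sup>2 * T"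
proof -
  interpret finite_measure "lebesgue_on {0..T}" by simp
  have "(\<integral>t. (norm (u t))\<^sup>2 \<partial>lebesgue_on {0..T}) \<le> (\<integral>t. (real CARD('m))\<^sup>2 \<partial>lebesgue_on {0..T})"
  proof (rule integral_mono_AE)
    show "integrable (lebesgue_on {0..T}) (\<lambda>t. (norm (u t))\<^sup>2)"
      using B_inf_square_integrable[OF u u] by (simp add: power2_norm_eq_inner)
    show "AE t in lebesgue_on {0..T}. (norm (u t))\<^sup>2 \<le> (real CARD('m))\<^sup>2"
      using B_inf_AE_norm_le[OF u] by eventually_elim (simp add: power_mono)
  qed simp
  also have "\<dots> = (real CARD('m))\<^sup>2 * T"
    using \<open>T > 0\<close> by (simp add: measure_restrict_space)
  finally show ?thesis .
qed

lemma L2_parallelogram: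
  fixes u v :: "real \<Rightarrow> real^'m"
  assumes u: "u \<in> B_inf T" and v: "v \<in> B_inf T"
  defines "M \<equiv> lebesgue_on {0..T}"
  shows "(\<integral>t. (norm (u t - v t))\<^sup>2 \<partial>M) = 2 * (\<integral>t. (norm (u t))\<^sup>2 \<partial>M) + 2 * (\<integral>t. (norm (v t))\<^sup>2 \<partial>M)
      - 4 * (\<integral>t. (norm (midpoint_control u v t))\<^sup>2 \<partial>M)"
proof -
  note w = B_inf_midpoint[OF u v]
  have "(\<integral>t. (norm (u t - v t))\<^sup>2 \<partial>M) = (\<integral>t. 2 * (u t \<bullet> u t) + 2 * (v t \<bullet> v t)
      - 4 * (midpoint_control u v t \<bullet> midpoint_control u v t) \<partial>M)"
    by (rule Bochner_Integration.integral_cong)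
      (auto simp: power2_norm_eq_inner midpoint_control_def inner_add_left inner_add_right
         inner_diff_left inner_diff_right inner_commute field_simps)
  also have "\<dots> = 2 * (\<integral>t. u t \<bullet> u t \<partial>M) + 2 * (\<integral>t. v t \<bullet> v t \<partial>M)
      - 4 * (\<integral>t. midpoint_control u v t \<bullet> midpoint_control u v t \<partial>M)"
    using B_inf_square_integrable[OF u u] B_inf_square_integrable[OF v v] B_inf_square_integrable[OF w w]
    by (simp add: M_def)
  finally show ?thesis by (simp add: power2_norm_eq_inner)
qed

section \<open>Passing to the limit\<close>

lemma B_inf_AE_limit:
  fixes v :: "nat \<Rightarrow> real \<Rightarrow> real^'m"
  assumes v: "\<And>k. v k \<in> B_inf T"
    and conv: "AE t in lebesgue_on {0..T}. convergent (\<lambda>k. v k t)"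
  obtains u where "u \<in> B_inf T" "AE t in lebesgue_on {0..T}. (\<lambda>k. v k t) \<longlonglongrightarrow> u t"
proof
  define u where "u t = lim (\<lambda>k. v k t)" for t
  show lim: "AE t in lebesgue_on {0..T}. (\<lambda>k. v k t) \<longlonglongrightarrow> u t"
    using conv by eventually_elim (simp add: u_def convergent_LIMSEQ_iff)
  have "u \<in> borel_measurable (lebesgue_on {0..T})"
    unfolding u_def by (rule borel_measurable_lim_metric) (use v in \<open>auto simp: B_inf_def\<close>)
  moreover have "AE t in lebesgue_on {0..T}. \<bar>u t $ i\<bar> \<le> 1" for i
  proof -
    have "AE t in lebesgue_on {0..T}. \<forall>k. \<bar>v k t $ i\<bar> \<le> 1"
      using v unfolding AE_all_countable by (auto simp: B_inf_def)
    with lim show ?thesis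
    proof eventually_elim
      case (elim t)
      then have "(\<lambda>k. \<bar>v k t $ i\<bar>) \<longlonglongrightarrow> \<bar>u t $ i\<bar>" by (intro tendsto_intros)
      then show ?case by (rule LIMSEQ_le_const2) (use elim in auto)
    qed
  qed
  ultimately show "u \<in> B_inf T" by (simp add: B_inf_def)
qed

lemma B_inf_AE_limit_L1:
  fixes v :: "nat \<Rightarrow> real \<Rightarrow> real^'m"
  assumes v: "\<And>k. v k \<in> B_inf T" and u: "u \<in> B_inf T"
    and lim: "AE t in lebesgue_on {0..T}. (\<lambda>k. v k t) \<longlonglongrightarrow> u t"
  shows "(\<lambda>k. \<integral>t. norm (v k t - u t) \<partial>lebesgue_on {0..T}) \<longlonglongrightarrow> 0"
proof -
  interpret finite_measure "lebesgue_on {0..T}" by simp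
  have [measurable]: "v k \<in> borel_measurable (lebesgue_on {0..T})" "u \<in> borel_measurable (lebesgue_on {0..T})" for k
    using v u by (auto simp: B_inf_def)
  have "(\<lambda>k. \<integral>t. norm (v k t - u t) \<partial>lebesgue_on {0..T}) \<longlonglongrightarrow> (\<integral>t. 0 \<partial>lebesgue_on {0..T})"
  proof (rule integral_dominated_convergence)
    show "integrable (lebesgue_on {0..T}) (\<lambda>t. 2 * real CARD('m))" by simp
    show "AE t in lebesgue_on {0..T}. norm (norm (v k t - u t)) \<le> 2 * real CARD('m)" for k
      using B_inf_AE_norm_le[OF v[of k]] B_inf_AE_norm_le[OF u]
    proof eventually_elim
      case (elim t)
      then show ?case using norm_triangle_ineq4[of "v k t" "u t"] by simp
    qed
    show "AE t in lebesgue_on {0..T}. (\<lambda>k. norm (v k t - u t)) \<longlonglongrightarrow> 0"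
      using lim by eventually_elim (simp add: tendsto_norm_zero LIM_zero)
  qed measurable
  then show ?thesis by simp
qed

text \<open>By the stability estimate the trajectories form a uniform Cauchy sequence, and the integral equation
survives the limit because its right-hand side converges in \<open>L\<^sup>1\<close>. This also
shows that the limit control has a trajectory at all.\<close>
lemma solution_limit:
  fixes A :: "real^'n^'n" and B :: "real^'m^'n"
  assumes "T > 0" and v: "\<And>k. v k \<in> B_inf T" and u: "u \<in> B_inf T"
    and lim: "(\<lambda>k. \<integral>t. norm (v k t - u t) \<partial>lebesgue_on {0..T}) \<longlonglongrightarrow> 0"
    and y: "\<And>k. is_solution A B T x0 (v k) (y k)"
  obtains x where "is_solution A B T x0 u x" "uniform_limit {0..T} y x sequentially"
proof -
  let ?M = "lebesgue_on {0..T}"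
  let ?a = "onorm ((*v) A)" and ?b = "onorm ((*v) B)"
  have a: "?a \<ge> 0" and b: "?b \<ge> 0" by (intro onorm_pos_le; simp)+
  define e where "e k = (\<integral>t. norm (v k t - u t) \<partial>?M)" for k
  define K where "K = ?b * exp (?a * T)"
  have "K \<ge> 0" using b by (simp add: K_def)
  have e_lim: "e \<longlonglongrightarrow> 0" using lim by (simp add: e_def[abs_def])
  have int: "integrable ?M (\<lambda>t. norm (v k t - u t))" for k
    using v u by (intro integrable_norm Bochner_Integration.integrable_diff B_inf_integrable)
  have close: "norm (y k t - y l t) \<le> K * (e k + e l)" if t: "t \<in> {0..T}" for k l t
  proof -
    have "(\<integral>s. norm (v k s - v l s) \<partial>?M) \<le> (\<integral>s. norm (v k s - u s) + norm (v l s - u s) \<partial>?M)"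
    proof (rule integral_mono)
      show "integrable ?M (\<lambda>s. norm (v k s - v l s))"
        using v by (intro integrable_norm Bochner_Integration.integrable_diff B_inf_integrable)
      show "integrable ?M (\<lambda>s. norm (v k s - u s) + norm (v l s - u s))"
        using int by (intro Bochner_Integration.integrable_add)
      show "norm (v k s - v l s) \<le> norm (v k s - u s) + norm (v l s - u s)" for s
        using norm_triangle_ineq4[of "v k s - u s" "v l s - u s"] by simp
    qed
    also have "\<dots> = e k + e l" using int by (simp add: e_def)
    finally show ?thesis
      using solution_stability[OF v v y y t, of k l] \<open>K \<ge> 0\<close> unfolding K_def[symmetric]
      by (meson mult_left_mono order_trans)
  qed
  define x where "x t = lim (\<lambda>k. y k t)" for t
  have x_lim: "(\<lambda>k. y k t) \<longlonglongrightarrow> x t" if t: "t \<in> {0..T}" for t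
  proof -
    have "Cauchy (\<lambda>k. y k t)"
    proof (rule CauchyI)
      fix \<epsilon> :: real assume "\<epsilon> > 0"
      have "(\<lambda>k. K * e k) \<longlonglongrightarrow> 0" using tendsto_mult_left[OF e_lim, of K] by simp
      then obtain P where P: "\<And>k. k \<ge> P \<Longrightarrow> norm (K * e k - 0) < \<epsilon> / 2"
        using LIMSEQ_D[of "\<lambda>k. K * e k" 0 "\<epsilon> / 2"] \<open>\<epsilon> > 0\<close> by auto
      have "norm (y k t - y l t) < \<epsilon>" if "k \<ge> P" "l \<ge> P" for k l
        using close[OF t, of k l] P[OF that(1)] P[OF that(2)] by (simp add: distrib_left)
      then show "\<exists>P. \<forall>k\<ge>P. \<forall>l\<ge>P. norm (y k t - y l t) < \<epsilon>" by blast
    qed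
    then show ?thesis unfolding x_def by (simp add: Cauchy_convergent_iff convergent_LIMSEQ_iff)
  qed
  have x_close: "norm (y k t - x t) \<le> K * e k" if t: "t \<in> {0..T}" for k t
  proof (rule LIMSEQ_le)
    show "(\<lambda>l. norm (y k t - y l t)) \<longlonglongrightarrow> norm (y k t - x t)" by (intro tendsto_intros x_lim t)
    have "(\<lambda>l. K * (e k + e l)) \<longlonglongrightarrow> K * (e k + 0)" by (intro tendsto_intros e_lim)
    then show "(\<lambda>l. K * (e k + e l)) \<longlonglongrightarrow> K * e k" by simp
    show "\<exists>P. \<forall>l\<ge>P. norm (y k t - y l t) \<le> K * (e k + e l)" using close[OF t] by blast
  qed
  have unif: "uniform_limit {0..T} y x sequentially"
  proof (rule uniform_limitI)
    fix \<epsilon> :: real assume "\<epsilon> > 0"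
    have "(\<lambda>k. K * e k) \<longlonglongrightarrow> 0" using tendsto_mult_left[OF e_lim, of K] by simp
    then have "eventually (\<lambda>k. K * e k < \<epsilon>) sequentially" using \<open>\<epsilon> > 0\<close> by (rule order_tendstoD)
    then show "\<forall>\<^sub>F k in sequentially. \<forall>t\<in>{0..T}. dist (y k t) (x t) < \<epsilon>"
    proof (rule eventually_mono, intro ballI)
      fix k t assume "K * e k < \<epsilon>" "t \<in> {0..T}"
      then show "dist (y k t) (x t) < \<epsilon>" using x_close[of t k] by (simp add: dist_norm)
    qed
  qed
  have x_cont: "continuous_on {0..T} x"
    by (rule uniform_limit_theorem[OF always_eventually unif])
      (auto intro: is_solution_continuous_on[OF y])
  have "is_solution A B T x0 u x"
  proof (rule has_integral_imp_is_solution[OF u x_cont \<open>T > 0\<close>])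
    fix t assume t: "t \<in> {0..T}"
    let ?g = "\<lambda>s. A *v x s + B *v u s" and ?h = "\<lambda>k s. A *v y k s + B *v v k s"
    have "?g integrable_on {0..T}"
      by (intro integrable_on_lebesgue_on rhs_integrable B_inf_integrable u x_cont) simp
    then have g: "?g integrable_on {0..t}" by (rule integrable_on_subinterval) (use t in auto)
    have h: "(?h k has_integral (y k t - x0)) {0..t}" for k
      by (rule is_solution_imp_has_integral[OF y t])
    have nH: "(\<lambda>s. norm (v k s - u s)) integrable_on {0..T}" for k
      using int by (intro integrable_on_lebesgue_on) auto
    then have n: "(\<lambda>s. norm (v k s - u s)) integrable_on {0..t}" for k
      by (rule integrable_on_subinterval) (use t in auto)
    have le: "norm ((y k t - x0) - integral {0..t} ?g) \<le> ?a * (K * e k) * t + ?b * e k" for k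
    proof -
      have "(y k t - x0) - integral {0..t} ?g = integral {0..t} (\<lambda>s. ?h k s - ?g s)"
        using h[of k] g by (subst integral_diff) (auto simp: integral_unique)
      also have "norm \<dots> \<le> integral {0..t} (\<lambda>s. ?a * (K * e k) + ?b * norm (v k s - u s))"
      proof (rule integral_norm_bound_integral)
        show "(\<lambda>s. ?h k s - ?g s) integrable_on {0..t}" using h[of k] g by (intro integrable_diff) auto
        show "(\<lambda>s. ?a * (K * e k) + ?b * norm (v k s - u s)) integrable_on {0..t}"
          using n[of k] by (intro integrable_add integrable_on_mult_right integrable_const_ivl)
        fix s assume s: "s \<in> {0..t}"
        have "norm (?h k s - ?g s) = norm (A *v (y k s - x s) + B *v (v k s - u s))"
          by (simp add: matrix_vector_mult_diff_distrib algebra_simps)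
        also have "\<dots> \<le> norm (A *v (y k s - x s)) + norm (B *v (v k s - u s))" by (rule norm_triangle_ineq)
        also have "\<dots> \<le> ?a * norm (y k s - x s) + ?b * norm (v k s - u s)"
          by (intro add_mono onorm) simp_all
        also have "\<dots> \<le> ?a * (K * e k) + ?b * norm (v k s - u s)"
          using s t a b by (intro add_mono mult_left_mono x_close) auto
        finally show "norm (?h k s - ?g s) \<le> ?a * (K * e k) + ?b * norm (v k s - u s)" .
      qed
      also have "\<dots> = ?a * (K * e k) * t + ?b * integral {0..t} (\<lambda>s. norm (v k s - u s))"
        using t n[of k] by (subst integral_add) (auto intro: integrable_on_mult_right)
      also have "\<dots> \<le> ?a * (K * e k) * t + ?b * e k"
      proof (rule add_left_mono[OF mult_left_mono[OF _ b]])
        have "integral {0..t} (\<lambda>s. norm (v k s - u s)) \<le> integral {0..T} (\<lambda>s. norm (v k s - u s))"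
          using t n[of k] nH[of k] by (intro integral_subset_le) auto
        also have "\<dots> = e k"
          using int[of k] unfolding e_def by (intro lebesgue_integral_eq_integral[symmetric]) auto
        finally show "integral {0..t} (\<lambda>s. norm (v k s - u s)) \<le> e k" .
      qed
      finally show ?thesis .
    qed
    have "(\<lambda>k. ?a * (K * e k) * t + ?b * e k) \<longlonglongrightarrow> ?a * (K * 0) * t + ?b * 0"
      by (intro tendsto_intros e_lim)
    then have "(\<lambda>k. ?a * (K * e k) * t + ?b * e k) \<longlonglongrightarrow> 0"
      by (simp only: mult_zero_right mult_zero_left add_0)
    then have "(\<lambda>k. (y k t - x0) - integral {0..t} ?g) \<longlonglongrightarrow> 0"
      by (rule Lim_null_comparison[OF always_eventually[OF allI[OF le]]])
    moreover have "(\<lambda>k. (y k t - x0) - integral {0..t} ?g) \<longlonglongrightarrow> (x t - x0) - integral {0..t} ?g"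
      by (intro tendsto_intros x_lim t)
    ultimately have "0 = (x t - x0) - integral {0..t} ?g"
      by (rule LIMSEQ_unique)
    then have "integral {0..t} ?g = x t - x0" by (simp only: eq_iff_diff_eq_0[of "x t - x0", symmetric] eq_commute[of 0])
    then show "(?g has_integral (x t - x0)) {0..t}" using g by (simp add: has_integral_integrable_integral)
  qed
  then show thesis using unif that by blast
qed

text \<open>Almost-everywhere convergence of uniformly bounded controls and uniform convergence of the
trajectories make dominated convergence applicable, so \<open>J\<close> is even continuous along the
sequence.\<close>
lemma J_limit:
  fixes A :: "real^'n^'n" and B :: "real^'m^'n"
  assumes N: "is_norm N" and v: "\<And>k. v k \<in> B_inf T" and u: "u \<in> B_inf T"
    and lim: "AE t in lebesgue_on {0..T}. (\<lambda>k. v k t) \<longlonglongrightarrow> u t"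
    and y: "\<And>k. is_solution A B T x0 (v k) (y k)" and x: "is_solution A B T x0 u x"
    and unif: "uniform_limit {0..T} y x sequentially"
  shows "(\<lambda>k. J A B Q N T x0 (v k)) \<longlonglongrightarrow> J A B Q N T x0 u"
proof -
  let ?M = "lebesgue_on {0..T}"
  interpret finite_measure ?M by simp
  have y_lim: "(\<lambda>k. y k t) \<longlonglongrightarrow> x t" if "t \<in> {0..T}" for t
    using tendsto_uniform_limitI[OF unif that] .
  have "compact (x ` {0..T})"
    using is_solution_continuous_on[OF x] by (intro compact_continuous_image) auto
  then obtain R where R: "\<And>t. t \<in> {0..T} \<Longrightarrow> norm (x t) \<le> R"
    using compact_imp_bounded bounded_iff by (metis image_eqI)
  obtain P where P: "\<And>k t. \<lbrakk>k \<ge> P; t \<in> {0..T}\<rbrakk> \<Longrightarrow> dist (y k t) (x t) < 1"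
    using uniform_limitD[OF unif zero_less_one] unfolding eventually_sequentially by blast
  have yR: "norm (y k t) \<le> R + 1" if "k \<ge> P" "t \<in> {0..T}" for k t
    using P[OF that] R[OF that(2)] norm_triangle_sub[of "y k t" "x t"] by (simp add: dist_norm)
  obtain C where C: "C \<ge> 0" "\<And>w. N w \<le> C * norm w" using is_norm_le_norm[OF N] by blast
  have N_lim: "(\<lambda>k. N (w k)) \<longlonglongrightarrow> N w'" if "w \<longlonglongrightarrow> w'" for w w'
    by (rule continuous_on_tendsto_compose[OF is_norm_continuous_on[OF N] that]) auto
  let ?c = "\<lambda>x u t. x t \<bullet> (Q *v x t) + N (u t)"
  have int: "integrable ?M (?c (y k) (v k))" "integrable ?M (?c x u)" for k
    using N v u y x by (auto intro!: cost_integrable is_solution_continuous_on)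
  have "(\<lambda>k. \<integral>t. ?c (y (k + P)) (v (k + P)) t \<partial>?M) \<longlonglongrightarrow> (\<integral>t. ?c x u t \<partial>?M)"
  proof (rule integral_dominated_convergence)
    let ?w = "(R + 1) * (onorm ((*v) Q) * (R + 1)) + C * CARD('m)"
    show "integrable ?M (\<lambda>t. ?w)" by simp
    show "AE t in ?M. (\<lambda>k. ?c (y (k + P)) (v (k + P)) t) \<longlonglongrightarrow> ?c x u t"
      using lim
    proof (rule AE_mp, intro AE_I2 impI)
      fix t assume t: "t \<in> space ?M" and "(\<lambda>k. v k t) \<longlonglongrightarrow> u t"
      then have "(\<lambda>k. ?c (y k) (v k) t) \<longlonglongrightarrow> ?c x u t"
        by (intro tendsto_intros N_lim y_lim bounded_linear.tendsto[OF matrix_vector_mul_bounded_linear]) auto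
      then show "(\<lambda>k. ?c (y (k + P)) (v (k + P)) t) \<longlonglongrightarrow> ?c x u t"
        by (rule LIMSEQ_ignore_initial_segment)
    qed
    show "AE t in ?M. norm (?c (y (k + P)) (v (k + P)) t) \<le> ?w" for k
      using B_inf_AE_norm_le[OF v[of "k + P"]]
    proof (rule AE_mp, intro AE_I2 impI)
      fix t assume t: "t \<in> space ?M" and vt: "norm (v (k + P) t) \<le> CARD('m)"
      let ?y = "y (k + P) t"
      have y1: "norm ?y \<le> R + 1" using t by (intro yR) auto
      then have "0 \<le> R + 1" by (rule order_trans[OF norm_ge_zero])
      have "norm (?y \<bullet> (Q *v ?y)) \<le> norm ?y * norm (Q *v ?y)"
        using Cauchy_Schwarz_ineq2[of ?y "Q *v ?y"] by simp
      also have "\<dots> \<le> norm ?y * (onorm ((*v) Q) * norm ?y)"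
        by (intro mult_left_mono onorm) simp_all
      also have "\<dots> \<le> (R + 1) * (onorm ((*v) Q) * (R + 1))"
        using y1 \<open>0 \<le> R + 1\<close> by (intro mult_mono mult_left_mono mult_nonneg_nonneg onorm_pos_le) simp_all
      finally have 1: "norm (?y \<bullet> (Q *v ?y)) \<le> (R + 1) * (onorm ((*v) Q) * (R + 1))" .
      have "N (v (k + P) t) \<le> C * CARD('m)"
        using C(2)[of "v (k + P) t"] mult_left_mono[OF vt C(1)] by linarith
      moreover have "0 \<le> N (v (k + P) t)" using N by (simp add: is_norm_def)
      ultimately have 2: "norm (N (v (k + P) t)) \<le> C * CARD('m)" by simp
      show "norm (?c (y (k + P)) (v (k + P)) t) \<le> ?w"
        by (rule norm_triangle_mono[OF 1 2])
    qed
  qed (use int in \<open>auto intro: borel_measurable_integrable\<close>)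
  then have "(\<lambda>k. \<integral>t. ?c (y k) (v k) t \<partial>?M) \<longlonglongrightarrow> (\<integral>t. ?c x u t \<partial>?M)"
    by (rule LIMSEQ_offset)
  then show ?thesis by (simp add: J_eq[OF v y] J_eq[OF u x])
qed

lemma J_nonneg:
  assumes "is_norm N" "nonneg_definite Q"
  shows "0 \<le> J A B Q N T x0 u"
  using assms unfolding J_def Let_def
  by (intro Bochner_Integration.integral_nonneg) (auto simp: is_norm_def nonneg_definite_def)

section \<open>Existence of an optimal control\<close>

theorem mainTheorem1:
  fixes A :: "real^'n^'n" and B :: "real^'m^'n" and Q :: "real^'n^'n"
    and N :: "real^'m \<Rightarrow> real" and T :: real and x0 xf :: "real^'n"
  assumes "is_norm N"
    and "nonneg_definite Q"
    and "T > 0"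
    and "\<exists>u \<in> B_inf T. takes A B T x0 xf u"
  shows "\<exists>ubar \<in> L1_controls N T \<inter> B_inf T. takes A B T x0 xf ubar \<and>
           (\<forall>u \<in> L1_controls N T \<inter> B_inf T. takes A B T x0 xf u \<longrightarrow>
              J A B Q N T x0 ubar \<le> J A B Q N T x0 u)"
proof -
  let ?M = "lebesgue_on {0..T}"
  let ?J = "J A B Q N T x0"
  let ?q = "\<lambda>u. \<integral>t. (norm (u t))\<^sup>2 \<partial>?M"
  \<comment> \<open>bounded controls are automatically in L1\<close>
  define S where "S = {u \<in> B_inf T. takes A B T x0 xf u}"
  obtain v where vS: "\<And>k. v k \<in> S"
    and vJ: "\<And>k u. u \<in> S \<Longrightarrow> ?J (v k) \<le> ?J u + inverse (real (Suc k))"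
    and vD: "\<And>k. (\<integral>t. (norm (v k t - v (Suc k) t))\<^sup>2 \<partial>?M) \<le> (1/4)^k"
  proof (rule near_minimizers_fast_sequence[of S 0 ?J 0 ?q "(real CARD('m))\<^sup>2 * T" midpoint_control
        "\<lambda>u v. \<integral>t. (norm (u t - v t))\<^sup>2 \<partial>?M" "\<lambda>k. (1/4)^k"])
    show "S \<noteq> {}" using assms(4) by (auto simp: S_def)
    show "0 \<le> ?J u" for u by (rule J_nonneg[OF assms(1,2)])
    show "?q u \<le> (real CARD('m))\<^sup>2 * T" if "u \<in> S" for u
      using that \<open>T > 0\<close> by (intro B_inf_L2_bound) (auto simp: S_def)
    fix u w assume "u \<in> S" "w \<in> S"
    then have u: "u \<in> B_inf T" and w: "w \<in> B_inf T"
      and "takes A B T x0 xf u" "takes A B T x0 xf w" by (auto simp: S_def)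
    then obtain x y where x: "is_solution A B T x0 u x" "x T = xf" and y: "is_solution A B T x0 w y" "y T = xf"
      unfolding takes_def by blast
    have "midpoint_control x y T = xf"
      unfolding midpoint_control_def x y by (simp flip: scaleR_2)
    then show "midpoint_control u w \<in> S"
      using B_inf_midpoint[OF u w] is_solution_midpoint[OF \<open>T > 0\<close> u w x(1) y(1)]
      unfolding S_def takes_def by blast
    show "?J (midpoint_control u w) \<le> max (?J u) (?J w)"
      by (rule order_trans[OF J_midpoint[OF assms(1-3) u x(1) w y(1)]]) (simp add: max_def)
    show "(\<integral>t. (norm (u t - w t))\<^sup>2 \<partial>?M) \<le> 2 * ?q u + 2 * ?q w - 4 * ?q (midpoint_control u w)"
      using L2_parallelogram[OF u w] by simp
  qed (auto intro: that)
  have vB: "v k \<in> B_inf T" for k using vS[of k] by (simp add: S_def)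
  have "AE t in ?M. convergent (\<lambda>k. v k t)"
  proof (rule AE_convergent_L2_fast[OF finite_measure_lebesgue_on_interval])
    show "v k \<in> borel_measurable ?M" for k using vB[of k] by (simp add: B_inf_def)
    show "integrable ?M (\<lambda>t. (norm (v k t - v (Suc k) t))\<^sup>2)" for k
      using B_inf_square_integrable[OF vB vB]
      by (simp add: power2_norm_eq_inner inner_diff_left inner_diff_right)
  qed (rule vD)
  then obtain u where u: "u \<in> B_inf T" and lim: "AE t in ?M. (\<lambda>k. v k t) \<longlonglongrightarrow> u t"
    by (rule B_inf_AE_limit[OF vB])
  have "\<forall>k. \<exists>y. is_solution A B T x0 (v k) y \<and> y T = xf"
    using vS by (auto simp: S_def takes_def)
  then obtain y where y: "\<And>k. is_solution A B T x0 (v k) (y k)" "\<And>k. y k T = xf" by metis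
  obtain x where x: "is_solution A B T x0 u x" and unif: "uniform_limit {0..T} y x sequentially"
    using solution_limit[OF \<open>T > 0\<close> vB u B_inf_AE_limit_L1[OF vB u lim] y(1)] by blast
  have "(\<lambda>k. y k T) \<longlonglongrightarrow> x T" by (rule tendsto_uniform_limitI[OF unif]) (use \<open>T > 0\<close> in simp)
  then have "x T = xf" unfolding y(2) by (simp add: LIMSEQ_const_iff)
  then have takes: "takes A B T x0 xf u" using x unfolding takes_def by blast
  have "?J u \<le> ?J w" if "w \<in> S" for w
  proof (rule LIMSEQ_le)
    show "(\<lambda>k. ?J (v k)) \<longlonglongrightarrow> ?J u" by (rule J_limit[OF assms(1) vB u lim y(1) x unif])
    show "(\<lambda>k. ?J w + inverse (real (Suc k))) \<longlonglongrightarrow> ?J w"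
      using tendsto_add[OF tendsto_const LIMSEQ_inverse_real_of_nat] by fastforce
    show "\<exists>P. \<forall>k\<ge>P. ?J (v k) \<le> ?J w + inverse (real (Suc k))" using vJ[OF that] by blast
  qed
  then show ?thesis
    using u takes B_inf_subset_L1_controls[OF assms(1), of T] by (intro bexI[of _ u]) (auto simp: S_def)
qed

end
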